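(* Let $M$ be a compact surface with $\chi(M)<0$, let $\mathfrak{T}$ be a triangular decomposition of $M$, and let $x\in\mathfrak{N}$ be an angle system. If there is a uniform angle system conformally equivalent to $x$, then it is unique. Moreover, if $(x+C)\cap\mathfrak{B}=\emptyset$, then there exists a uniform angle system conformally equivalent to $x$.
   Context: $M$ is a compact two-dimensional surface, possibly with boundary, with $\chi(M)<0$. A triangular decomposition $\mathfrak{T}$ of $M$ is a cell decomposition of $M$ that lifts to a triangulation of the universal cover of $M$. $V,E,F$ denote the sets of vertices, edges and triangles of $\mathfrak{T}$ (and also their cardinalities), and $\partial V,\partial E$ the sets of boundary vertices and boundary edges. Incidences of triangles, edges and corners are counted as in the universal cover (with multiplicity); each $e\in E-\partial E$ has two sides, occupied by triangles $t_1,t_2$. The $3F$ corners (angle slots) $\alpha_i$ of the triangles are taken as the basis of $\mathbb{R}^{3F}$, with dual basis $\alpha^i$; $\alpha^i(x)$ is the angle which $x$ assigns to slot $\alpha_i$. For a triangle $t$, $d^t(x)$ is the unordered triple of the angles assigned by $x$ to the three slots of $t$, $\sigma^t(x)$ is their sum, and $k^t(x)=\sigma^t(x)-\pi$. For a vertex $v$, $p^v(x)$ is the sum of the angles of $x$ over all slots at $v$. Put $$\mathfrak{V}=\{x\in\mathbb{R}^{3F}: p^v(x)=2\pi \text{ for } v\in V-\partial V,\ p^v(x)=\pi\text{ for } v\in\partial V\},$$ $$\mathfrak{N}=\{x\in\mathfrak{V}: k^t(x)<0 \text{ for all } t,\ \alpha^i(x)\in(0,\pi)\text{ for all } i\}.$$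 Points of $\mathfrak{N}$ are called angle systems, and $\partial\mathfrak{N}$ is the boundary of $\mathfrak{N}$ in the affine space $\mathfrak{V}$. For $x\in\mathfrak{N}$ each triangle $t$ is realized by a hyperbolic triangle with angles $d^t(x)$; for an edge $e$ of $t$ let $l^e_t(x)$ be the hyperbolic length of $e$ in this realization. An angle system $u$ is uniform if all the hyperbolic realizations of the triangles fit together to form a hyperbolic structure on $M$, i.e. $l^e_{t_1}(u)=l^e_{t_2}(u)$ for every $e\in E-\partial E$ with triangles $t_1,t_2$ on its two sides. For $e\in E-\partial E$ with triangles $t_1,t_2$ on its two sides, $w_e\in\mathbb{R}^{3F}$ is the vector with coefficient $+1$ at the two slots of $t_1$ adjacent to $e$ (those at the endpoints of $e$), $-1$ at the two slots of $t_2$ adjacent to $e$, and $0$ elsewhere (contributions being added if $t_1=t_2$); the choice of which side is positive is immaterial. Put $C=\mathrm{span}\{w_e: e\in E-\partial E\}$. Points $x,y$ are conformally equivalent if $x-y\in C$. For $x\in\partial\mathfrak{N}$, a triangle $t$ is called legal with respect to $x$ if $d^t(x)\neq\{0,0,\pi\}$ and either $k^t(x)=0$ or some angle in $d^t(x)$ equals $0$. Put $\mathfrak{B}=\{x\in\partial\mathfrak{N}: \text{no triangle of } \mathfrak{T} \text{ is legal with respect to } x\}$. *)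

theory Defs
  imports "HOL-Analysis.Analysis" "HOL-Library.Multiset"
begin

section \<open>Compact surfaces with boundary\<close>

text \<open>
  Hausdorffness comes from the ambient type class; second countability follows from compactness.
\<close>

definition compact_surface :: "'a::t2_space set \<Rightarrow> bool" where
  "compact_surface M \<longleftrightarrow> compact M \<and> connected M \<and>
     (\<forall>x\<in>M. \<exists>W. openin (top_of_set M) W \<and> x \<in> W \<and>
        (\<exists>H. openin (top_of_set {z::complex. 0 \<le> Im z}) H \<and> W homeomorphic H))"

definition surface_interior :: "'a::t2_space set \<Rightarrow> 'a set" where
  "surface_interior M =
     {x\<in>M. \<exists>W. openin (top_of_set M) W \<and> x \<in> W \<and> (\<exists>H::complex set. open H \<and> W homeomorphic H)}"

definition surface_boundary :: "'a::t2_space set \<Rightarrow> 'a set" where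
  "surface_boundary M = M - surface_interior M"

section \<open>Triangular decompositions\<close>

text \<open>
  The standard triangle is given in barycentric coordinates indexed by the type \<open>3\<close>, whose
  arithmetic is modulo 3.  Side \<open>i\<close> is opposite to corner \<open>i\<close>, so that its end points are
  the corners \<open>i + 1\<close> and \<open>i + 2\<close>.
\<close>

definition std_triangle :: "(real^3) set" where
  "std_triangle = {b. (\<forall>i. 0 \<le> b $ i) \<and> (\<Sum>i\<in>UNIV. b $ i) = 1}"

definition face :: "3 set \<Rightarrow> (real^3) set" where
  "face J = {b\<in>std_triangle. \<forall>i. i \<notin> J \<longrightarrow> b $ i = 0}"

definition open_face :: "3 set \<Rightarrow> (real^3) set" where
  "open_face J = {b\<in>std_triangle. \<forall>i. 0 < b $ i \<longleftrightarrow> i \<in> J}"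

definition corner :: "3 \<Rightarrow> real^3" where
  "corner i = axis i 1"

text \<open>
  The triangles are indexed by a finite type \<open>'f\<close>, and \<open>\<phi> t\<close> is the characteristic map of
  the 2-cell \<open>t\<close>.  The open cells are the images of the open faces; a vertex or an edge may be
  the image of several faces, even of the same triangle, whereas distinct indices give distinct
  2-cells.
\<close>

definition cell_decomposition ::
    "'a::t2_space set \<Rightarrow> ('f::finite \<Rightarrow> real^3 \<Rightarrow> 'a) \<Rightarrow> bool" where
  "cell_decomposition M \<phi> \<longleftrightarrow>
     (\<forall>t. continuous_on std_triangle (\<phi> t)) \<and>
     (\<Union>t. \<phi> t ` std_triangle) = M \<and>
     (\<forall>t J. inj_on (\<phi> t) (open_face J)) \<and>
     (\<forall>t t' J J'. \<phi> t ` open_face J \<inter> \<phi> t' ` open_face J' \<noteq> {} \<longrightarrow>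
        \<phi> t ` open_face J = \<phi> t' ` open_face J' \<and> card J = card J' \<and> (J = UNIV \<longrightarrow> t = t'))"

text \<open>
  A (possibly infinite) triangulation in the sense of simplicial complexes: a locally finite
  family of embedded triangles covering the space, any two of which are disjoint or meet in a
  common face (\<open>face {}\<close> is empty).
\<close>

definition triangulates :: "(real^3 \<Rightarrow> 'b::t2_space) set \<Rightarrow> 'b set \<Rightarrow> bool" where
  "triangulates \<Psi> U \<longleftrightarrow>
     (\<forall>\<psi>\<in>\<Psi>. continuous_on std_triangle \<psi> \<and> inj_on \<psi> std_triangle) \<and>
     (\<Union>\<psi>\<in>\<Psi>. \<psi> ` std_triangle) = U \<and>
     (\<forall>\<psi>\<in>\<Psi>. \<forall>\<psi>'\<in>\<Psi>. \<exists>J J'. \<psi> ` std_triangle \<inter> \<psi>' ` std_triangle = \<psi> ` face J \<and>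
                           \<psi> ` face J = \<psi>' ` face J') \<and>
     (\<forall>u\<in>U. \<exists>W. openin (top_of_set U) W \<and> u \<in> W \<and>
        finite {T. \<exists>\<psi>\<in>\<Psi>. T = \<psi> ` std_triangle \<and> T \<inter> W \<noteq> {}})"

definition lifts :: "'b::t2_space set \<Rightarrow> ('b \<Rightarrow> 'a::t2_space) \<Rightarrow> ('f::finite \<Rightarrow> real^3 \<Rightarrow> 'a) \<Rightarrow>
    (real^3 \<Rightarrow> 'b) set" where
  "lifts U p \<phi> = {\<psi>. continuous_on std_triangle \<psi> \<and> \<psi> ` std_triangle \<subseteq> U \<and>
                     (\<exists>t. \<forall>b\<in>std_triangle. p (\<psi> b) = \<phi> t b)}"

definition universal_cover :: "'b::t2_space set \<Rightarrow> ('b \<Rightarrow> 'a::t2_space) \<Rightarrow> 'a set \<Rightarrow> bool" where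
  "universal_cover U p M \<longleftrightarrow> covering_space U p M \<and> simply_connected U"

definition triangular_decomposition ::
    "'a::t2_space set \<Rightarrow> 'b::t2_space set \<Rightarrow> ('b \<Rightarrow> 'a) \<Rightarrow> ('f::finite \<Rightarrow> real^3 \<Rightarrow> 'a) \<Rightarrow> bool" where
  "triangular_decomposition M U p \<phi> \<longleftrightarrow>
     cell_decomposition M \<phi> \<and> universal_cover U p M \<and> triangulates (lifts U p \<phi>) U"

definition vertices :: "('f::finite \<Rightarrow> real^3 \<Rightarrow> 'a) \<Rightarrow> 'a set" where
  "vertices \<phi> = {\<phi> t (corner i) | t i. True}"

definition side :: "('f::finite \<Rightarrow> real^3 \<Rightarrow> 'a) \<Rightarrow> 'f \<times> 3 \<Rightarrow> 'a set" where
  "side \<phi> s = \<phi> (fst s) ` open_face (- {snd s})"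

definition edges :: "('f::finite \<Rightarrow> real^3 \<Rightarrow> 'a) \<Rightarrow> 'a set set" where
  "edges \<phi> = range (side \<phi>)"

definition boundary_vertices ::
    "'a::t2_space set \<Rightarrow> ('f::finite \<Rightarrow> real^3 \<Rightarrow> 'a) \<Rightarrow> 'a set" where
  "boundary_vertices M \<phi> = {v \<in> vertices \<phi>. v \<in> surface_boundary M}"

definition boundary_edges ::
    "'a::t2_space set \<Rightarrow> ('f::finite \<Rightarrow> real^3 \<Rightarrow> 'a) \<Rightarrow> 'a set set" where
  "boundary_edges M \<phi> = {e \<in> edges \<phi>. e \<subseteq> surface_boundary M}"

definition euler_characteristic :: "('f::finite \<Rightarrow> real^3 \<Rightarrow> 'a) \<Rightarrow> int" where
  "euler_characteristic \<phi> = int (card (vertices \<phi>)) - int (card (edges \<phi>)) + int CARD('f)"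

section \<open>Angle systems\<close>

text \<open>
  The slot \<open>(t, i)\<close> is the corner \<open>i\<close> of the triangle \<open>t\<close>.  As the standard triangle lifts
  uniquely once one of its points is lifted, the slots \<open>(t, i)\<close> with \<open>\<phi> t (corner i) = v\<close> are in
  bijection with the corners around any lift of \<open>v\<close>, so multiplicities are those of the
  universal cover.  Likewise, the pairs \<open>s\<close> with \<open>side \<phi> s = e\<close> are the sides of \<open>e\<close>.
\<close>

definition angles :: "real^('f::finite \<times> 3) \<Rightarrow> 'f \<Rightarrow> real multiset" where
  "angles x t = image_mset (\<lambda>i. x $ (t, i)) (mset_set UNIV)"

definition angle_sum :: "real^('f::finite \<times> 3) \<Rightarrow> 'f \<Rightarrow> real" where
  "angle_sum x t = (\<Sum>i\<in>UNIV. x $ (t, i))"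

definition curvature :: "real^('f::finite \<times> 3) \<Rightarrow> 'f \<Rightarrow> real" where
  "curvature x t = angle_sum x t - pi"

definition vertex_sum ::
    "('f::finite \<Rightarrow> real^3 \<Rightarrow> 'a) \<Rightarrow> real^('f \<times> 3) \<Rightarrow> 'a \<Rightarrow> real" where
  "vertex_sum \<phi> x v = (\<Sum>s | \<phi> (fst s) (corner (snd s)) = v. x $ s)"

definition V_space ::
    "'a::t2_space set \<Rightarrow> ('f::finite \<Rightarrow> real^3 \<Rightarrow> 'a) \<Rightarrow> (real^('f \<times> 3)) set" where
  "V_space M \<phi> = {x. (\<forall>v \<in> vertices \<phi> - boundary_vertices M \<phi>. vertex_sum \<phi> x v = 2 * pi) \<and>
                     (\<forall>v \<in> boundary_vertices M \<phi>. vertex_sum \<phi> x v = pi)}"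

definition angle_systems ::
    "'a::t2_space set \<Rightarrow> ('f::finite \<Rightarrow> real^3 \<Rightarrow> 'a) \<Rightarrow> (real^('f \<times> 3)) set" where
  "angle_systems M \<phi> =
     {x \<in> V_space M \<phi>. (\<forall>t. curvature x t < 0) \<and> (\<forall>s. 0 < x $ s \<and> x $ s < pi)}"

definition angle_systems_boundary ::
    "'a::t2_space set \<Rightarrow> ('f::finite \<Rightarrow> real^3 \<Rightarrow> 'a) \<Rightarrow> (real^('f \<times> 3)) set" where
  "angle_systems_boundary M \<phi> = top_of_set (V_space M \<phi>) frontier_of angle_systems M \<phi>"

section \<open>Hyperbolic triangles\<close>

text \<open>
  The hyperboloid model of the hyperbolic plane in Minkowski space \<open>real \<times> complex\<close>, with the
  real factor as time axis.  The geodesic from \<open>P\<close> to \<open>Q\<close> leaves \<open>P\<close> in the direction of the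
  component of \<open>Q\<close> that is orthogonal to \<open>P\<close>.
\<close>

definition mink :: "real \<times> complex \<Rightarrow> real \<times> complex \<Rightarrow> real" where
  "mink P Q = snd P \<bullet> snd Q - fst P * fst Q"

definition hyperbolic_plane :: "(real \<times> complex) set" where
  "hyperbolic_plane = {P. mink P P = -1 \<and> 0 < fst P}"

definition hyp_dist :: "real \<times> complex \<Rightarrow> real \<times> complex \<Rightarrow> real" where
  "hyp_dist P Q = arcosh (- mink P Q)"

definition hyp_direction :: "real \<times> complex \<Rightarrow> real \<times> complex \<Rightarrow> real \<times> complex" where
  "hyp_direction P Q = Q + mink P Q *\<^sub>R P"

definition hyp_angle :: "real \<times> complex \<Rightarrow> real \<times> complex \<Rightarrow> real \<times> complex \<Rightarrow> real" where
  "hyp_angle P Q R =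
     (let a = hyp_direction P Q; b = hyp_direction P R
      in arccos (mink a b / (sqrt (mink a a) * sqrt (mink b b))))"

definition realizes :: "(3 \<Rightarrow> real \<times> complex) \<Rightarrow> (3 \<Rightarrow> real) \<Rightarrow> bool" where
  "realizes P A \<longleftrightarrow> range P \<subseteq> hyperbolic_plane \<and> inj P \<and>
     (\<forall>i. hyp_angle (P i) (P (i + 1)) (P (i + 2)) = A i)"

definition side_length :: "real^('f::finite \<times> 3) \<Rightarrow> 'f \<times> 3 \<Rightarrow> real" where
  "side_length x s =
     (THE l. \<exists>P. realizes P (\<lambda>i. x $ (fst s, i)) \<and> l = hyp_dist (P (snd s + 1)) (P (snd s + 2)))"

definition uniform ::
    "'a::t2_space set \<Rightarrow> ('f::finite \<Rightarrow> real^3 \<Rightarrow> 'a) \<Rightarrow> real^('f \<times> 3) \<Rightarrow> bool" where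
  "uniform M \<phi> u \<longleftrightarrow> u \<in> angle_systems M \<phi> \<and>
     (\<forall>e \<in> edges \<phi> - boundary_edges M \<phi>. \<forall>s s'. side \<phi> s = e \<and> side \<phi> s' = e \<longrightarrow>
        side_length u s = side_length u s')"

section \<open>Conformal equivalence\<close>

definition side_vector :: "'f::finite \<times> 3 \<Rightarrow> real^('f \<times> 3)" where
  "side_vector s = axis (fst s, snd s + 1) 1 + axis (fst s, snd s + 2) 1"

text \<open>
  Both choices of the positive side of an edge occur among the generators; this does not affect
  the span.
\<close>

definition C_space ::
    "'a::t2_space set \<Rightarrow> ('f::finite \<Rightarrow> real^3 \<Rightarrow> 'a) \<Rightarrow> (real^('f \<times> 3)) set" where
  "C_space M \<phi> = span {side_vector s - side_vector s' | s s'.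
     s \<noteq> s' \<and> side \<phi> s = side \<phi> s' \<and> side \<phi> s \<in> edges \<phi> - boundary_edges M \<phi>}"

definition conformally_equivalent ::
    "'a::t2_space set \<Rightarrow> ('f::finite \<Rightarrow> real^3 \<Rightarrow> 'a) \<Rightarrow> real^('f \<times> 3) \<Rightarrow> real^('f \<times> 3) \<Rightarrow> bool" where
  "conformally_equivalent M \<phi> x y \<longleftrightarrow> x - y \<in> C_space M \<phi>"

definition legal :: "real^('f::finite \<times> 3) \<Rightarrow> 'f \<Rightarrow> bool" where
  "legal x t \<longleftrightarrow> angles x t \<noteq> {#0, 0, pi#} \<and> (curvature x t = 0 \<or> 0 \<in># angles x t)"

definition bad_boundary ::
    "'a::t2_space set \<Rightarrow> ('f::finite \<Rightarrow> real^3 \<Rightarrow> 'a) \<Rightarrow> (real^('f \<times> 3)) set" where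
  "bad_boundary M \<phi> = {x \<in> angle_systems_boundary M \<phi>. \<forall>t. \<not> legal x t}"

end

theory Submission
  imports Defs "HOL-Real_Asymp.Real_Asymp"
begin

text \<open>
  The proof is variational.  Over a hyperbolic triangle with angles \<open>A, B, C\<close> stands an ideal
  prism, whose three edges orthogonal to the triangle have the dihedral angles \<open>A, B, C\<close> and whose
  other edges have the dihedral angles \<open>h + A, h + B, h + C\<close>, where \<open>h = (pi - A - B - C) / 2\<close>.
  Its volume is, up to an additive constant, the sum of the values of the Lobachevsky function at
  the seven numbers \<open>A, B, C, h, h + A, h + B, h + C\<close>.  Let \<open>H\<close> be the sum of these volumes over
  all triangles.  Three properties of \<open>H\<close> give the theorem.

  First, the derivative of \<open>H\<close> in the direction that increases the two angles adjacent to a side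
  of length \<open>a\<close> at unit speed is \<open>ln ((cosh a - 1) / 2)\<close>
  (\<open>prism_volume_deriv_side_vector\<close>).  This is a strictly increasing function of \<open>a\<close>, so the two
  sides of an interior edge are equally long if and only if the derivative of \<open>H\<close> vanishes along
  the corresponding generator of \<open>C\<close>.  Hence the uniform angle systems are the critical points of
  \<open>H\<close> on the conformal classes (\<open>uniform_iff_critical\<close>).

  Secondly, \<open>H\<close> is strictly concave (\<open>prism_volume_strictly_concave\<close>), so a conformal class has at
  most one critical point.

  Thirdly, \<open>H\<close> extends continuously to the closure of the conformal class, which is compact, and
  so has a maximum there.  On the way from a boundary point \<open>y\<close> into the interior, the derivative
  of \<open>H\<close> behaves like \<open>- \<kappa> ln s\<close> plus a bounded term.  A triangle contributes to \<open>\<kappa>\<close> the sum of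
  the rates of change of those of its seven numbers that are \<open>0\<close> or \<open>pi\<close> at \<open>y\<close>.  This is positive
  for a legal triangle, and \<open>0\<close> for the others, where for the angles \<open>0, 0, pi\<close> the seven rates cancel
  (\<open>boundary_coefficient\<close>).  So a boundary point with a legal triangle is not a maximum
  (\<open>prism_volume_increases_off_boundary\<close>).  If the conformal class avoids the bad boundary, the
  maximum is therefore interior, hence critical, hence uniform.

  The maximum lies in the space of the vertex equations because a conformal change preserves the
  angle sums at the vertices: sides that carry the same edge have the same end points
  (\<open>vertex_sum_C_space\<close>).
\<close>

section \<open>Indices modulo 3\<close>

lemma three_add [simp]:
  fixes i :: 3
  shows "i + 1 + 1 = i + 2" "i + 1 + 2 = i" "i + 2 + 1 = i" "i + 2 + 2 = i + 1"
proof -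
  have "(1::3) + 1 = 2" "(1::3) + 2 = 0" "(2::3) + 1 = 0" "(2::3) + 2 = 1" by simp_all
  then show "i + 1 + 1 = i + 2" "i + 1 + 2 = i" "i + 2 + 1 = i" "i + 2 + 2 = i + 1"
    by (simp_all only: add.assoc add_0_right)
qed

lemma three_neq [simp]:
  fixes i :: 3
  shows "i + 1 \<noteq> i" "i + 2 \<noteq> i" "i + 1 \<noteq> i + 2" "i \<noteq> i + 1" "i \<noteq> i + 2" "i + 2 \<noteq> i + 1"
  by simp_all

text \<open>
  A triangle is often viewed from one of its corners \<open>i\<close>; this and the next two lemmas split
  statements about all corners accordingly.
\<close>
lemma UNIV_three: "(UNIV :: 3 set) = {i, i + 1, i + 2}"
proof -
  have "j \<in> {i, i + 1, i + 2}" for j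
  proof -
    have "(3::3) = 0" by simp
    then have "j - i = 0 \<or> j - i = 1 \<or> j - i = 2" using exhaust_3[of "j - i"] by metis
    then show ?thesis by (metis add.commute add_0 diff_add_cancel insertCI)
  qed
  then show ?thesis by blast
qed

lemma all_three: "(\<forall>j. P (j::3)) \<longleftrightarrow> P i \<and> P (i + 1) \<and> P (i + 2)"
  using UNIV_three[of i] by (metis UNIV_I insertE singletonD)

lemma sum_three: "(\<Sum>j\<in>UNIV. f (j::3)) = f i + f (i + 1) + (f (i + 2) :: 'z::comm_monoid_add)"
  by (subst UNIV_three[of i]) (simp add: add.assoc)

section \<open>The Lobachevsky function\<close>

text \<open>
  The usual integrand is \<open>ln (2 sin u)\<close>.  Without the factor 2 the function changes by a linear term,
  and the prism volume only by a constant, since the seven arguments for a triangle add up to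
  \<open>2 pi\<close>.
\<close>
definition lobachevsky :: "real \<Rightarrow> real" where
  "lobachevsky \<theta> = - integral {0..\<theta>} (\<lambda>u. ln (sin u))"

lemma sin_over_id_continuous:
  "continuous_on UNIV (\<lambda>u::real. if u = 0 then 1 else sin u / u)"
proof -
  have "isCont (\<lambda>u::real. if u = 0 then 1 else sin u / u) u" for u
  proof (cases "u = 0")
    case True
    have "(\<lambda>u::real. sin u / u) \<midarrow>0\<rightarrow> 1" by real_asymp
    then have "(\<lambda>u::real. if u = 0 then 1 else sin u / u) \<midarrow>0\<rightarrow> 1"
      by (rule Lim_transform_eventually) (auto simp: eventually_at_filter)
    then show ?thesis using True by (simp add: isCont_def)
  next
    case False
    have "isCont (\<lambda>u. sin u / u) u" using False by (intro continuous_intros)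
    moreover have "\<forall>\<^sub>F v in nhds u. sin v / v = (if v = 0 then 1 else sin v / v)"
      using t1_space_nhds[OF False] by eventually_elim auto
    ultimately show ?thesis by (rule isCont_cong[THEN iffD1, rotated])
  qed
  then show ?thesis by (simp add: continuous_at_imp_continuous_on)
qed

lemma mult_ln_continuous: "continuous_on {0..} (\<lambda>u::real. u * ln u)"
proof -
  have "((\<lambda>u::real. u * ln u) \<longlongrightarrow> a * ln a) (at a within {0..})" if "a \<ge> 0" for a
  proof (cases "a = 0")
    case True
    have "((\<lambda>u::real. u * ln u) \<longlongrightarrow> 0) (at_right 0)" by real_asymp
    moreover have "at (0::real) within {0..} = at_right 0"
      by (metis at_within_Ici_at_right)
    ultimately show ?thesis using True by simp
  next
    case False
    then have "a > 0" using that by simp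
    then show ?thesis by (auto intro!: tendsto_intros)
  qed
  then show ?thesis by (simp add: continuous_on_def)
qed

text \<open>
  The singularities of \<open>ln (sin u)\<close> at \<open>0\<close> and \<open>pi\<close> are those of \<open>ln u + ln (pi - u)\<close>, which has an
  explicit antiderivative that is continuous up to the end points.  By the half-angle formula
  \<open>sin u = 2 sin (u/2) sin ((pi - u)/2)\<close>, the remaining summand is the continuous function \<open>k\<close>.
\<close>
lemma log_sine_antiderivative:
  obtains F :: "real \<Rightarrow> real" where "continuous_on {0..pi} F"
    "\<And>u. 0 < u \<Longrightarrow> u < pi \<Longrightarrow> (F has_real_derivative ln (sin u)) (at u)"
proof -
  define q where "q = (\<lambda>u::real. if u = 0 then 1 else sin u / u)"
  define k where "k = (\<lambda>u. ln (q (u / 2) * q ((pi - u) / 2) / 2))"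
  have qc: "continuous_on A (\<lambda>u. q (f u))" if "continuous_on A f" for A and f :: "real \<Rightarrow> real"
    using continuous_on_compose2[OF sin_over_id_continuous that] by (simp add: q_def)
  have qpos: "q u > 0" if "0 \<le> u" "u < pi" for u
    using that sin_gt_zero[of u] by (auto simp: q_def)
  have nz: "q (u / 2) * q ((pi - u) / 2) / 2 \<noteq> 0" if "u \<in> {0..pi}" for u
  proof -
    have "0 < q (u / 2)" "0 < q ((pi - u) / 2)" using that pi_gt_zero by (intro qpos; simp; linarith)+
    then show ?thesis by simp
  qed
  have kc: "continuous_on {0..pi} k"
    unfolding k_def by (intro continuous_intros qc) (use nz in auto)
  define F where "F = (\<lambda>u. integral {0..u} k + (u * ln u - u) - ((pi - u) * ln (pi - u) - (pi - u)))"
  have c1: "continuous_on {0..pi} (\<lambda>u. integral {0..u} k)"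
    by (rule indefinite_integral_continuous_1[OF integrable_continuous_real[OF kc]])
  have c2: "continuous_on {0..pi} (\<lambda>u. u * ln u)"
    by (rule continuous_on_subset[OF mult_ln_continuous]) auto
  have c3: "continuous_on {0..pi} (\<lambda>u. (pi - u) * ln (pi - u))"
    by (rule continuous_on_compose2[OF mult_ln_continuous, of _ "\<lambda>u. pi - u"]) (auto intro!: continuous_intros)
  have 1: "continuous_on {0..pi} F"
    unfolding F_def by (intro continuous_on_add continuous_on_diff c1 c2 c3 continuous_on_id continuous_on_const)
  have 2: "(F has_real_derivative ln (sin u)) (at u)" if "0 < u" "u < pi" for u
  proof -
    have "((\<lambda>u. integral {0..u} k) has_real_derivative k u) (at u within {0..pi})"
      using integral_has_real_derivative[OF kc, of u] that by simp
    then have "((\<lambda>u. integral {0..u} k) has_real_derivative k u) (at u)"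
      using that by (simp add: at_within_Icc_at)
    moreover have "((\<lambda>u. u * ln u - u) has_real_derivative ln u) (at u)"
      using that by (auto intro!: derivative_eq_intros)
    moreover have "((\<lambda>u. (pi - u) * ln (pi - u) - (pi - u)) has_real_derivative - ln (pi - u)) (at u)"
      using that by (auto intro!: derivative_eq_intros)
    ultimately have "(F has_real_derivative k u + ln u - - ln (pi - u)) (at u)"
      unfolding F_def by (intro DERIV_add DERIV_diff)
    moreover have "k u + ln u - - ln (pi - u) = ln (sin u)"
    proof -
      have "sin u = 2 * sin (u/2) * sin (pi/2 - u/2)"
        using sin_double[of "u/2"] cos_sin_eq[of "u/2"] by simp
      also have "pi/2 - u/2 = (pi - u)/2" by (simp add: field_simps)
      finally have s: "sin u = (q (u / 2) * q ((pi - u) / 2) / 2) * (u * (pi - u))"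
        using that by (simp add: q_def)
      have "q (u / 2) * q ((pi - u) / 2) / 2 > 0" using that qpos[of "u / 2"] qpos[of "(pi - u) / 2"] by simp
      moreover have "ln z + ln u - - ln (pi - u) = ln (z * (u * (pi - u)))" if "z > 0" for z
        using that \<open>0 < u\<close> \<open>u < pi\<close> by (simp add: ln_mult)
      ultimately show ?thesis unfolding k_def s by blast
    qed
    ultimately show ?thesis by simp
  qed
  show thesis using that 1 2 by blast
qed

lemma lobachevsky_regular:
  shows lobachevsky_continuous: "continuous_on {0..pi} lobachevsky"
    and lobachevsky_deriv: "0 < u \<Longrightarrow> u < pi \<Longrightarrow> (lobachevsky has_real_derivative - ln (sin u)) (at u)"
proof -
  obtain F where F: "continuous_on {0..pi} F"
    "\<And>u. 0 < u \<Longrightarrow> u < pi \<Longrightarrow> (F has_real_derivative ln (sin u)) (at u)"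
    by (rule log_sine_antiderivative) blast
  have L: "lobachevsky u = F 0 - F u" if "u \<in> {0..pi}" for u
  proof -
    have "((\<lambda>u. ln (sin u)) has_integral (F u - F 0)) {0..u}"
      by (rule fundamental_theorem_of_calculus_interior)
        (use that F in \<open>auto simp: has_real_derivative_iff_has_vector_derivative[symmetric] intro: continuous_on_subset\<close>)
    then show ?thesis by (simp add: lobachevsky_def integral_unique)
  qed
  show "continuous_on {0..pi} lobachevsky"
    by (subst continuous_on_cong[OF refl L]) (auto intro!: continuous_intros F(1))
  assume u: "0 < u" "u < pi"
  have "((\<lambda>u. F 0 - F u) has_real_derivative - ln (sin u)) (at u)"
    using F(2)[OF u] by (auto intro!: derivative_eq_intros)
  then show "(lobachevsky has_real_derivative - ln (sin u)) (at u)"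
    by (rule has_field_derivative_transform_within_open[where S = "{0<..<pi}"]) (use u L in auto)
qed

text \<open>
  Near \<open>s = 0\<close>, a summand whose argument starts at \<open>0\<close> or \<open>pi\<close> is \<open>b k * ln s\<close> up to a
  convergent term, while the other summands converge.  In both cases the sign of \<open>b k\<close> is that of the
  direction into the interval, so negative coefficients come from arguments that start at \<open>pi\<close>.
\<close>
lemma deriv_log_sine_sum_at_top:
  fixes a b :: "'k::finite \<Rightarrow> real"
  assumes a: "\<And>k. 0 \<le> a k \<and> a k \<le> pi" and ab: "\<And>k. 0 < a k + b k \<and> a k + b k < pi"
    and pos: "(\<Sum>k | a k = 0 \<or> a k = pi. b k) > 0"
  shows "filterlim (\<lambda>s. - (\<Sum>k\<in>UNIV. b k * ln (sin (a k + s * b k)))) at_top (at_right 0)"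
proof -
  let ?E = "{k. a k = 0 \<or> a k = pi}"
  define \<kappa> where "\<kappa> = (\<Sum>k\<in>?E. b k)"
  define r where "r = (\<lambda>k s. if k \<in> ?E then b k * ln (sin (s * \<bar>b k\<bar>) / s) else b k * ln (sin (a k + s * b k)))"
  have "\<exists>l. (r k \<longlongrightarrow> l) (at_right 0)" for k
  proof (cases "k \<in> ?E")
    case True
    define \<beta> where "\<beta> = \<bar>b k\<bar>"
    have "\<beta> > 0" using True ab[of k] by (auto simp: \<beta>_def)
    then have "((\<lambda>s. sin (s * \<beta>) / s) \<longlongrightarrow> \<beta>) (at_right 0)" by real_asymp
    then have "((\<lambda>s. b k * ln (sin (s * \<beta>) / s)) \<longlongrightarrow> b k * ln \<beta>) (at_right 0)"
      using \<open>\<beta> > 0\<close> by (auto intro!: tendsto_intros)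
    then show ?thesis using True by (auto simp: r_def \<beta>_def)
  next
    case False
    then have "sin (a k) > 0" using a[of k] by (intro sin_gt_zero) auto
    then have "((\<lambda>s. b k * ln (sin (a k + s * b k))) \<longlongrightarrow> b k * ln (sin (a k + 0 * b k))) (at_right 0)"
      by (intro tendsto_intros) auto
    then show ?thesis using False by (auto simp: r_def)
  qed
  then obtain l where l: "\<And>k. (r k \<longlongrightarrow> l k) (at_right 0)" by metis
  have R: "((\<lambda>s. - (\<Sum>k\<in>UNIV. r k s)) \<longlongrightarrow> - (\<Sum>k\<in>UNIV. l k)) (at_right 0)"
    using l by (intro tendsto_intros)
  have "\<kappa> > 0" using pos by (simp add: \<kappa>_def)
  then have "filterlim (\<lambda>s. - (\<kappa> * ln s)) at_top (at_right 0)" by real_asymp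
  then have lim: "filterlim (\<lambda>s. - (\<Sum>k\<in>UNIV. r k s) + - (\<kappa> * ln s)) at_top (at_right 0)"
    using R by (rule filterlim_tendsto_add_at_top[rotated])
  have "- (\<Sum>k\<in>UNIV. r k s) + - (\<kappa> * ln s) = - (\<Sum>k\<in>UNIV. b k * ln (sin (a k + s * b k)))"
    if s: "0 < s" "s < 1" for s
  proof -
    have "b k * ln (sin (a k + s * b k)) = r k s + (if k \<in> ?E then b k * ln s else 0)" for k
    proof (cases "k \<in> ?E")
      case True
      then have e: "sin (a k + s * b k) = sin (s * \<bar>b k\<bar>)" using ab[of k] by (auto simp: sin_add)
      have b: "0 < \<bar>b k\<bar>" "\<bar>b k\<bar> < pi" using True ab[of k] by auto
      have "s * \<bar>b k\<bar> < 1 * pi" using s b by (intro mult_strict_mono) auto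
      then have "sin (s * \<bar>b k\<bar>) > 0" using s b by (intro sin_gt_zero) auto
      then show ?thesis using True s by (simp add: r_def e ln_div algebra_simps)
    qed (simp add: r_def)
    then have "(\<Sum>k\<in>UNIV. b k * ln (sin (a k + s * b k)))
        = (\<Sum>k\<in>UNIV. r k s) + (\<Sum>k\<in>UNIV. if k \<in> ?E then b k * ln s else 0)"
      by (simp add: sum.distrib)
    also have "(\<Sum>k\<in>UNIV. if k \<in> ?E then b k * ln s else 0) = \<kappa> * ln s"
      by (simp add: sum.If_cases \<kappa>_def sum_distrib_right)
    finally show ?thesis by simp
  qed
  moreover have "\<forall>\<^sub>F s::real in at_right 0. 0 < s \<and> s < 1"
    by (rule eventually_at_rightI[of 0 1]) auto
  ultimately have "\<forall>\<^sub>F s in at_right 0. - (\<Sum>k\<in>UNIV. r k s) + - (\<kappa> * ln s)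
      = - (\<Sum>k\<in>UNIV. b k * ln (sin (a k + s * b k)))"
    by (auto elim: eventually_mono)
  then show ?thesis using lim by (rule filterlim_cong[OF refl refl, THEN iffD1])
qed

section \<open>A positive definite form on the angles of a triangle\<close>

text \<open>
  The relation \<open>cot p cot q + cot q cot r + cot r cot p = 1\<close> for the angles of a Euclidean triangle
  says that the quadratic form, restricted to the plane \<open>a + b + c = 0\<close>, has determinant 1.
  Completing the square displays the vanishing of \<open>b\<close>; as the form is symmetric in the three
  angles, this single conclusion yields definiteness.
\<close>
lemma triangle_cot_form:
  fixes p q r a b c :: real
  assumes "0 < p" "0 < q" "0 < r" "p + q + r = pi" "a + b + c = 0"
  shows triangle_cot_form_nonneg: "0 \<le> cot p * a\<^sup>2 + cot q * b\<^sup>2 + cot r * c\<^sup>2" (is "0 \<le> ?Q")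
    and triangle_cot_form_zero: "cot p * a\<^sup>2 + cot q * b\<^sup>2 + cot r * c\<^sup>2 \<le> 0 \<Longrightarrow> b = 0"
proof -
  have s: "sin p > 0" "sin q > 0" "sin r > 0" using assms by (auto intro!: sin_gt_zero)
  have qe: "q = pi - (p + r)" using assms by simp
  have sq: "sin q = sin p * cos r + cos p * sin r" unfolding qe by (simp add: sin_add)
  have cq: "cos q = sin p * sin r - cos p * cos r" unfolding qe by (simp add: cos_add)
  have g: "cot p + cot r = sin q / (sin p * sin r)" using s by (simp add: cot_def sq field_simps)
  \<comment> \<open>The coefficient of \<open>a\<^sup>2\<close> after eliminating \<open>c\<close>; multiplying by it completes the square.\<close>
  have pos: "cot p + cot r > 0" unfolding g using s by simp
  have one: "(cot p + cot r) * cot q + cot p * cot r = 1"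
    unfolding g using s by (simp add: cot_def cq field_simps)
  have ce: "c = - (a + b)" using assms by simp
  have "(cot p + cot r) * ?Q = ((cot p + cot r) * a + cot r * b)\<^sup>2 + ((cot p + cot r) * cot q + cot p * cot r) * b\<^sup>2"
    unfolding ce by algebra
  then have e: "(cot p + cot r) * ?Q = ((cot p + cot r) * a + cot r * b)\<^sup>2 + b\<^sup>2" using one by simp
  then have "(cot p + cot r) * ?Q \<ge> 0" by simp
  then show "?Q \<ge> 0" using pos by (simp add: zero_le_mult_iff)
  assume "?Q \<le> 0"
  then have "(cot p + cot r) * ?Q \<le> 0" using pos by (simp add: mult_le_0_iff)
  then have "b\<^sup>2 \<le> 0" using e by (smt (verit) zero_le_power2)
  then show "b = 0" by simp
qed

text \<open>
  Two angles may be replaced by their sum at the cost of decreasing the form.  This reduces the four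
  angles \<open>A, B, C, 2h\<close> in the next result to the three angles of a Euclidean triangle.
\<close>
lemma cot_merge:
  fixes p q a b :: real
  assumes "0 < p" "0 < q" "p + q < pi"
  shows "cot (p + q) * (a + b)\<^sup>2 \<le> cot p * a\<^sup>2 + cot q * b\<^sup>2"
proof -
  have "cot (pi - (p + q)) = - cot (p + q)" by (simp add: cot_def)
  moreover have "0 \<le> cot p * a\<^sup>2 + cot q * b\<^sup>2 + cot (pi - (p + q)) * (- (a + b))\<^sup>2"
    by (rule triangle_cot_form_nonneg) (use assms in auto)
  ultimately show ?thesis by (simp add: power2_eq_square algebra_simps)
qed

lemma cot_half_ge:
  fixes p :: real assumes "0 < p" "p < pi / 2"
  shows "2 * cot (2 * p) \<le> cot p"
proof -
  have "sin p > 0" "cos p > 0" using assms by (auto intro!: sin_gt_zero cos_gt_zero)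
  have "cot p - 2 * cot (2 * p) = (2 * (cos p)\<^sup>2 - 2 * cos (2*p)) / (2 * sin p * cos p)"
    using \<open>sin p > 0\<close> \<open>cos p > 0\<close>
    unfolding cot_def sin_double by (simp add: field_simps power2_eq_square)
  also have "2 * (cos p)\<^sup>2 - 2 * cos (2*p) = 2 * (sin p)\<^sup>2" by (simp add: cos_double)
  finally have e: "cot p - 2 * cot (2 * p) = 2 * (sin p)\<^sup>2 / (2 * sin p * cos p)" .
  have "cot p - 2 * cot (2 * p) \<ge> 0" unfolding e
    using \<open>sin p > 0\<close> \<open>cos p > 0\<close> by simp
  then show ?thesis by simp
qed

text \<open>
  \<open>Q\<close> is minus the Hessian of the volume of one prism, in the direction \<open>(a, b, c)\<close>; \<open>e\<close> is the
  change of \<open>h\<close>.  The angles at an ideal vertex of the prism add up to \<open>pi\<close>, as in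
  \<open>(h + A) + (h + B) + C = pi\<close>.  Summing the Euclidean forms of the three such triples counts each
  \<open>h + A\<close> twice and each \<open>A\<close> once, so that \<open>2 Q\<close> is this sum plus a form in \<open>A, B, C, h\<close>.  The
  latter is nonnegative because \<open>A + B + C + 2h = pi\<close> and \<open>cot h \<ge> 2 cot (2h)\<close>, and the three
  triples make the whole definite.
\<close>
lemma prism_hessian_posdef:
  fixes A B C h a b c e :: real
  assumes pos: "0 < A" "0 < B" "0 < C" "0 < h" and sum: "2 * h + A + B + C = pi"
    and e: "2 * e + a + b + c = 0"
  defines "Q \<equiv> cot A * a\<^sup>2 + cot B * b\<^sup>2 + cot C * c\<^sup>2 + cot h * e\<^sup>2
     + (cot (h + A) * (e + a)\<^sup>2 + cot (h + B) * (e + b)\<^sup>2 + cot (h + C) * (e + c)\<^sup>2)"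
  shows "0 \<le> Q" and "Q \<le> 0 \<Longrightarrow> a = 0 \<and> b = 0 \<and> c = 0"
proof -
  \<comment> \<open>The form of a Euclidean triangle; it is applied to the angles at the three ideal vertices
    and to the triple \<open>A, B, C + 2h\<close>.\<close>
  define T where "T = (\<lambda>p q r x y z :: real. cot p * x\<^sup>2 + cot q * y\<^sup>2 + cot r * z\<^sup>2)"
  have T1: "0 \<le> T (h + A) C (h + B) (e + a) c (e + b)" "T (h + A) C (h + B) (e + a) c (e + b) \<le> 0 \<Longrightarrow> c = 0"
    using triangle_cot_form[of "h + A" "C" "h + B" "e + a" "c" "e + b"] pos sum e by (simp_all add: T_def)
  have T2: "0 \<le> T (h + B) A (h + C) (e + b) a (e + c)" "T (h + B) A (h + C) (e + b) a (e + c) \<le> 0 \<Longrightarrow> a = 0"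
    using triangle_cot_form[of "h + B" "A" "h + C" "e + b" "a" "e + c"] pos sum e by (simp_all add: T_def)
  have T3: "0 \<le> T (h + A) B (h + C) (e + a) b (e + c)" "T (h + A) B (h + C) (e + a) b (e + c) \<le> 0 \<Longrightarrow> b = 0"
    using triangle_cot_form[of "h + A" "B" "h + C" "e + a" "b" "e + c"] pos sum e by (simp_all add: T_def)
  have "0 \<le> T A B (C + 2 * h) a b (c + 2 * e)"
    unfolding T_def by (rule triangle_cot_form_nonneg) (use pos sum e in auto)
  moreover have "cot (C + 2 * h) * (c + 2 * e)\<^sup>2 \<le> cot C * c\<^sup>2 + cot (2 * h) * (2 * e)\<^sup>2"
    by (rule cot_merge) (use pos sum in auto)
  moreover have "cot (2 * h) * (2 * e)\<^sup>2 \<le> 2 * (cot h * e\<^sup>2)"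
  proof -
    have "cot (2 * h) * (2 * e)\<^sup>2 = 2 * cot (2 * h) * (2 * e\<^sup>2)" by (simp add: power2_eq_square)
    also have "\<dots> \<le> cot h * (2 * e\<^sup>2)"
      by (rule mult_right_mono[OF cot_half_ge]) (use pos sum in auto)
    finally show ?thesis by simp
  qed
  ultimately have R: "0 \<le> cot A * a\<^sup>2 + cot B * b\<^sup>2 + cot C * c\<^sup>2 + 2 * (cot h * e\<^sup>2)"
    unfolding T_def by linarith
  have "2 * Q = T (h + A) C (h + B) (e + a) c (e + b) + T (h + B) A (h + C) (e + b) a (e + c)
      + T (h + A) B (h + C) (e + a) b (e + c)
      + (cot A * a\<^sup>2 + cot B * b\<^sup>2 + cot C * c\<^sup>2 + 2 * (cot h * e\<^sup>2))"
    unfolding Q_def T_def by (simp add: algebra_simps)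
  then show "0 \<le> Q" "Q \<le> 0 \<Longrightarrow> a = 0 \<and> b = 0 \<and> c = 0"
    using T1 T2 T3 R by linarith+
qed

section \<open>Hyperbolic triangles and their side lengths\<close>

lemma mink_simps [simp]:
  "mink (P + Q) R = mink P R + mink Q R" "mink R (P + Q) = mink R P + mink R Q"
  "mink (c *\<^sub>R P) R = c * mink P R" "mink R (c *\<^sub>R P) = c * mink R P"
  by (simp_all add: mink_def algebra_simps)

lemma mink_commute: "mink P Q = mink Q P"
  by (simp add: mink_def inner_commute mult.commute)

text \<open>
  The reversed Cauchy-Schwarz inequality for timelike vectors, with its case of equality.
\<close>
lemma mink_less_minus_one:
  assumes "P \<in> hyperbolic_plane" "Q \<in> hyperbolic_plane" "P \<noteq> Q"
  shows "mink P Q < -1"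
proof -
  obtain t z where P: "P = (t, z)" by (cases P)
  obtain u w where Q: "Q = (u, w)" by (cases Q)
  have t: "t\<^sup>2 = 1 + (norm z)\<^sup>2" "t > 0" and u: "u\<^sup>2 = 1 + (norm w)\<^sup>2" "u > 0"
    using assms by (auto simp: P Q hyperbolic_plane_def mink_def power2_norm_eq_inner simp flip: power2_eq_square)
  have le: "norm z < t" "norm w < u"
    using t u by (auto intro: power2_less_imp_less)
  have "z \<bullet> w \<le> norm z * norm w" by (rule norm_cauchy_schwarz)
  have sq: "(t * u)\<^sup>2 = (1 + norm z * norm w)\<^sup>2 + (norm z - norm w)\<^sup>2"
    unfolding power_mult_distrib t(1) u(1) by algebra
  have ge: "1 + norm z * norm w \<le> t * u"
    by (rule power2_le_imp_le) (use sq t u in auto)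
  have "z \<bullet> w < t * u - 1"
  proof (rule ccontr)
    assume "\<not> ?thesis"
    then have e: "z \<bullet> w = norm z * norm w" "t * u = 1 + norm z * norm w"
      using ge \<open>z \<bullet> w \<le> _\<close> by auto
    then have "norm z = norm w" using sq by simp
    then have "z = w" using e(1) norm_cauchy_schwarz_eq[of z w] by (cases "w = 0") auto
    moreover have "t = u" using t u \<open>norm z = norm w\<close> power2_eq_iff_nonneg[of t u] by simp
    ultimately show False using assms P Q by simp
  qed
  then show ?thesis by (simp add: mink_def P Q)
qed

text \<open>
  Minus the determinant of the Gram matrix of three unit timelike vectors whose mutual Minkowski
  products are \<open>-a, -b, -c\<close>.
\<close>
definition gram :: "real \<Rightarrow> real \<Rightarrow> real \<Rightarrow> real" where
  "gram a b c = 1 + 2 * a * b * c - a\<^sup>2 - b\<^sup>2 - c\<^sup>2"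

text \<open>
  The Gram determinant is minus the square of the determinant formed by the coordinates, because the
  Minkowski form has determinant \<open>-1\<close>.
\<close>
lemma gram_nonneg:
  assumes "P \<in> hyperbolic_plane" "Q \<in> hyperbolic_plane" "R \<in> hyperbolic_plane"
  shows "0 \<le> gram (- mink Q R) (- mink P R) (- mink P Q)"
proof -
  obtain t x y where P: "P = (t, Complex x y)" by (metis complex.collapse prod.collapse)
  obtain t' x' y' where Q: "Q = (t', Complex x' y')" by (metis complex.collapse prod.collapse)
  obtain t'' x'' y'' where R: "R = (t'', Complex x'' y'')" by (metis complex.collapse prod.collapse)
  have e: "x * x + y * y - t * t = -1" "x' * x' + y' * y' - t' * t' = -1" "x'' * x'' + y'' * y'' - t'' * t'' = -1"
    using assms by (auto simp: P Q R hyperbolic_plane_def mink_def inner_complex_def)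
  have "gram (- mink Q R) (- mink P R) (- mink P Q) =
     (t * (x' * y'' - x'' * y') - x * (t' * y'' - t'' * y') + y * (t' * x'' - t'' * x'))\<^sup>2"
    unfolding gram_def using e by (simp add: P Q R mink_def inner_complex_def) algebra
  then show ?thesis by simp
qed

text \<open>
  In the hyperboloid model the law of cosines is a computation: \<open>hyp_direction P Q\<close> has square
  length \<open>c\<^sup>2 - 1\<close>, and the product of the two directions at \<open>P\<close> is \<open>b c - a\<close>.
\<close>
lemma hyp_angle_eq:
  assumes "P \<in> hyperbolic_plane" "Q \<in> hyperbolic_plane" "R \<in> hyperbolic_plane"
    and "a = - mink Q R" "b = - mink P R" "c = - mink P Q"
  shows "hyp_angle P Q R = arccos ((b * c - a) / (sqrt (c\<^sup>2 - 1) * sqrt (b\<^sup>2 - 1)))"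
proof -
  have 1: "mink P P = -1" "mink Q Q = -1" "mink R R = -1" using assms by (auto simp: hyperbolic_plane_def)
  show ?thesis
    using assms(4-6) mink_commute[of Q P] mink_commute[of R P] mink_commute[of R Q]
    by (simp add: hyp_angle_def hyp_direction_def 1 Let_def power2_eq_square algebra_simps)
qed

text \<open>
  That \<open>gram a b c\<close> is nonnegative is what keeps the argument of \<open>arccos\<close> in \<open>[-1, 1]\<close>.
\<close>
lemma cos_sin_arccos_gram:
  assumes "1 < b" "1 < c" "0 \<le> gram a b c"
    and "A = arccos ((b * c - a) / (sqrt (c\<^sup>2 - 1) * sqrt (b\<^sup>2 - 1)))"
  shows "cos A = (b * c - a) / (sqrt (c\<^sup>2 - 1) * sqrt (b\<^sup>2 - 1))"
    and "sin A = sqrt (gram a b c) / (sqrt (c\<^sup>2 - 1) * sqrt (b\<^sup>2 - 1))"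
proof -
  let ?r = "(b * c - a) / (sqrt (c\<^sup>2 - 1) * sqrt (b\<^sup>2 - 1))"
  have p: "c\<^sup>2 - 1 > 0" "b\<^sup>2 - 1 > 0" using assms by (auto simp: power2_eq_square less_1_mult)
  have r2: "?r\<^sup>2 = (b * c - a)\<^sup>2 / ((c\<^sup>2 - 1) * (b\<^sup>2 - 1))"
    using p by (simp add: power_divide power_mult_distrib)
  have "(c\<^sup>2 - 1) * (b\<^sup>2 - 1) - (b * c - a)\<^sup>2 = gram a b c" unfolding gram_def by algebra
  moreover have "1 - x / y = (y - x) / y" if "y \<noteq> 0" for x y :: real using that by (simp add: diff_divide_distrib)
  ultimately have one: "1 - ?r\<^sup>2 = gram a b c / ((c\<^sup>2 - 1) * (b\<^sup>2 - 1))"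
    unfolding r2 using p by simp
  then have "1 - ?r\<^sup>2 \<ge> 0" using assms p by simp
  then have "\<bar>?r\<bar> \<le> 1" by (simp add: abs_square_le_1)
  then have r: "-1 \<le> ?r" "?r \<le> 1" by linarith+
  show "cos A = ?r" unfolding assms(4) by (rule cos_arccos[OF r])
  have "sin A = sqrt (1 - ?r\<^sup>2)" unfolding assms(4) by (rule sin_arccos[OF r])
  then show "sin A = sqrt (gram a b c) / (sqrt (c\<^sup>2 - 1) * sqrt (b\<^sup>2 - 1))"
    unfolding one by (simp add: real_sqrt_divide real_sqrt_mult)
qed

text \<open>
  The dual law of cosines: the hyperbolic cosine of the side opposite to \<open>A\<close>.
\<close>
definition cosh_side :: "real \<Rightarrow> real \<Rightarrow> real \<Rightarrow> real" where
  "cosh_side A B C = (cos A + cos B * cos C) / (sin B * sin C)"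

lemma dual_law_of_cosines:
  assumes H: "P \<in> hyperbolic_plane" "Q \<in> hyperbolic_plane" "R \<in> hyperbolic_plane"
    and ne: "P \<noteq> Q" "Q \<noteq> R" "R \<noteq> P"
    and "A = hyp_angle P Q R" "B = hyp_angle Q R P" "C = hyp_angle R P Q"
    and sin: "sin B \<noteq> 0"
  shows "- mink Q R = cosh_side A B C"
proof -
  define a b c where abc: "a = - mink Q R" "b = - mink P R" "c = - mink P Q"
  have gt: "1 < a" "1 < b" "1 < c"
    using H ne mink_less_minus_one[of Q R] mink_less_minus_one[of P R] mink_less_minus_one[of P Q] by (auto simp: abc)
  have G: "0 \<le> gram a b c" using gram_nonneg[OF H] by (simp add: abc)
  have abc': "c = - mink Q P" "b = - mink R P" "a = - mink R Q" using abc mink_commute by metis+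
  have A: "A = arccos ((b * c - a) / (sqrt (c\<^sup>2 - 1) * sqrt (b\<^sup>2 - 1)))"
    using hyp_angle_eq[OF H abc] assms by simp
  have B: "B = arccos ((c * a - b) / (sqrt (a\<^sup>2 - 1) * sqrt (c\<^sup>2 - 1)))"
    using hyp_angle_eq[OF H(2,3,1) abc'(2,1) abc(1)] assms by simp
  have C: "C = arccos ((a * b - c) / (sqrt (b\<^sup>2 - 1) * sqrt (a\<^sup>2 - 1)))"
    using hyp_angle_eq[OF H(3,1,2) abc(3) abc'(3,2)] assms by simp
  define u v w where uvw: "u = sqrt (a\<^sup>2 - 1)" "v = sqrt (b\<^sup>2 - 1)" "w = sqrt (c\<^sup>2 - 1)"
  have p: "u > 0" "v > 0" "w > 0" "u\<^sup>2 = a\<^sup>2 - 1"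
    using gt by (auto simp: uvw power2_eq_square less_1_mult less_imp_le)
  define g where "g = gram a b c"
  have gs: "gram a b c = g" "gram b c a = g" "gram c a b = g" by (simp_all add: g_def gram_def)
  have g0: "g \<ge> 0" using G gs by simp
  have cA: "cos A = (b * c - a) / (w * v)"
    using cos_sin_arccos_gram(1)[OF gt(2,3) _ A] gs g0 by (simp add: uvw)
  have cB: "cos B = (c * a - b) / (u * w)" "sin B = sqrt g / (u * w)"
    using cos_sin_arccos_gram[OF gt(3,1) _ B] gs g0 by (simp_all add: uvw)
  have cC: "cos C = (a * b - c) / (v * u)" "sin C = sqrt g / (v * u)"
    using cos_sin_arccos_gram[OF gt(1,2) _ C] gs g0 by (simp_all add: uvw)
  have g: "g \<noteq> 0" using sin cB(2) by auto
  have "sin B * sin C = g / (u\<^sup>2 * v * w)"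
    using g0 p(1-3) unfolding cB cC by (simp add: power2_eq_square)
  moreover have "cos A + cos B * cos C = ((b * c - a) * u\<^sup>2 + (c * a - b) * (a * b - c)) / (u\<^sup>2 * v * w)"
    using p(1-3) unfolding cA cB cC by (simp add: field_simps power2_eq_square)
  moreover have "(b * c - a) * u\<^sup>2 + (c * a - b) * (a * b - c) = a * g"
    unfolding p(4) g_def gram_def by algebra
  ultimately have "cosh_side A B C = a" using g p(1-3) by (simp add: cosh_side_def)
  then show ?thesis by (simp add: abc)
qed

lemma one_less_cosh_side:
  assumes "0 < A" "0 < B" "0 < C" "A + B + C < pi"
  shows "1 < cosh_side A B C"
proof -
  have s: "sin B > 0" "sin C > 0" using assms by (auto intro!: sin_gt_zero)
  have "cos A > cos (pi - (B + C))" using assms by (intro cos_monotone_0_pi) auto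
  then have "cos A + cos B * cos C > sin B * sin C" by (simp add: cos_add)
  then show ?thesis using s by (simp add: cosh_side_def)
qed

text \<open>
  Inverting the dual law: lengths that are computed from the angles satisfy the ordinary law of
  cosines.  The quantity \<open>N\<close> is symmetric in the angles; it is minus the Gram determinant
  of the unit normals of the sides.
\<close>
lemma law_of_cosines_cosh_side:
  fixes A B C :: real
  assumes pos: "0 < A" "0 < B" "0 < C" "A + B + C < pi"
  defines "a \<equiv> cosh_side A B C" and "b \<equiv> cosh_side B C A" and "c \<equiv> cosh_side C A B"
  shows "b * c - a = cos A * (sqrt (c\<^sup>2 - 1) * sqrt (b\<^sup>2 - 1))"
proof -
  define N where "N = (cos A)\<^sup>2 + (cos B)\<^sup>2 + (cos C)\<^sup>2 + 2 * cos A * cos B * cos C - 1"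
  have s: "sin A > 0" "sin B > 0" "sin C > 0" using pos by (auto intro!: sin_gt_zero)
  have sA: "(sin A)\<^sup>2 = 1 - (cos A)\<^sup>2" and sB: "(sin B)\<^sup>2 = 1 - (cos B)\<^sup>2" and sC: "(sin C)\<^sup>2 = 1 - (cos C)\<^sup>2"
    by (simp_all add: sin_squared_eq)
  have c2: "c\<^sup>2 - 1 = N / ((sin A)\<^sup>2 * (sin B)\<^sup>2)"
  proof -
    have "c\<^sup>2 - 1 = ((cos C + cos A * cos B)\<^sup>2 - (sin A)\<^sup>2 * (sin B)\<^sup>2) / ((sin A)\<^sup>2 * (sin B)\<^sup>2)"
      using s by (simp add: c_def cosh_side_def field_simps)
    also have "(cos C + cos A * cos B)\<^sup>2 - (sin A)\<^sup>2 * (sin B)\<^sup>2 = N"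
      unfolding sA sB N_def by algebra
    finally show ?thesis .
  qed
  have b2: "b\<^sup>2 - 1 = N / ((sin A)\<^sup>2 * (sin C)\<^sup>2)"
  proof -
    have "b\<^sup>2 - 1 = ((cos B + cos C * cos A)\<^sup>2 - (sin A)\<^sup>2 * (sin C)\<^sup>2) / ((sin A)\<^sup>2 * (sin C)\<^sup>2)"
      using s by (simp add: b_def cosh_side_def field_simps)
    also have "(cos B + cos C * cos A)\<^sup>2 - (sin A)\<^sup>2 * (sin C)\<^sup>2 = N"
      unfolding sA sC N_def by algebra
    finally show ?thesis .
  qed
  have "1 < c" using one_less_cosh_side[of C A B] pos by (simp add: c_def)
  then have "c\<^sup>2 - 1 > 0" by (simp add: power2_eq_square less_1_mult)
  then have "0 < N / ((sin A)\<^sup>2 * (sin B)\<^sup>2)" by (simp only: c2)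
  moreover have "0 < (sin A)\<^sup>2 * (sin B)\<^sup>2" using s by simp
  ultimately have N: "N > 0" by (simp only: zero_less_divide_iff) linarith
  have "sqrt (c\<^sup>2 - 1) * sqrt (b\<^sup>2 - 1) = N / ((sin A)\<^sup>2 * sin B * sin C)"
    unfolding c2 b2 using N s
    by (simp add: real_sqrt_divide real_sqrt_mult power2_eq_square field_simps)
  moreover have "b * c - a = ((cos B + cos C * cos A) * (cos C + cos A * cos B)
      - (sin A)\<^sup>2 * (cos A + cos B * cos C)) / ((sin A)\<^sup>2 * sin B * sin C)"
    using s by (simp add: a_def b_def c_def cosh_side_def field_simps power2_eq_square)
  moreover have "(cos B + cos C * cos A) * (cos C + cos A * cos B)
      - (sin A)\<^sup>2 * (cos A + cos B * cos C) = cos A * N"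
    unfolding sA N_def by algebra
  ultimately show ?thesis by simp
qed

lemma hyp_angle_from_sides:
  assumes pos: "0 < A" "0 < B" "0 < C" "A + B + C < pi"
    and H: "P \<in> hyperbolic_plane" "Q \<in> hyperbolic_plane" "R \<in> hyperbolic_plane"
    and "mink Q R = - cosh_side A B C" "mink P R = - cosh_side B C A" "mink P Q = - cosh_side C A B"
  shows "hyp_angle P Q R = A"
proof -
  let ?a = "cosh_side A B C" and ?b = "cosh_side B C A" and ?c = "cosh_side C A B"
  have "1 < ?b" "1 < ?c" using one_less_cosh_side pos by auto
  then have "sqrt (?c\<^sup>2 - 1) * sqrt (?b\<^sup>2 - 1) \<noteq> 0" by (simp add: power2_eq_1_iff)
  then have "(?b * ?c - ?a) / (sqrt (?c\<^sup>2 - 1) * sqrt (?b\<^sup>2 - 1)) = cos A"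
    using law_of_cosines_cosh_side[OF pos] by simp
  then show ?thesis
    using hyp_angle_eq[OF H, of ?a ?b ?c] assms by (simp add: arccos_cos)
qed

text \<open>
  Two sides of the required lengths are laid off from the base point of the hyperboloid at the angle
  \<open>A\<close>; the law of cosines gives the third side, and then the other two angles.
\<close>
lemma hyperbolic_triangle_exists:
  assumes pos: "0 < A" "0 < B" "0 < C" "A + B + C < pi"
  obtains P Q R where "P \<in> hyperbolic_plane" "Q \<in> hyperbolic_plane" "R \<in> hyperbolic_plane"
    "P \<noteq> Q" "Q \<noteq> R" "R \<noteq> P"
    "hyp_angle P Q R = A" "hyp_angle Q R P = B" "hyp_angle R P Q = C"
proof -
  let ?a = "cosh_side A B C" and ?b = "cosh_side B C A" and ?c = "cosh_side C A B"
  have gt: "1 < ?a" "1 < ?b" "1 < ?c" using one_less_cosh_side pos by auto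
  then have g2: "?b\<^sup>2 - 1 > 0" "?c\<^sup>2 - 1 > 0" by (auto simp: power2_eq_square less_1_mult)
  define P :: "real \<times> complex" where "P = (1, 0)"
  define Q where "Q = (?c, Complex (sqrt (?c\<^sup>2 - 1)) 0)"
  define R where "R = (?b, Complex (sqrt (?b\<^sup>2 - 1) * cos A) (sqrt (?b\<^sup>2 - 1) * sin A))"
  have "sqrt (?b\<^sup>2 - 1) * cos A * (sqrt (?b\<^sup>2 - 1) * cos A) + sqrt (?b\<^sup>2 - 1) * sin A * (sqrt (?b\<^sup>2 - 1) * sin A)
     = (sqrt (?b\<^sup>2 - 1))\<^sup>2 * ((sin A)\<^sup>2 + (cos A)\<^sup>2)" by algebra
  also have "\<dots> = ?b\<^sup>2 - 1" using g2 by simp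
  finally have r: "sqrt (?b\<^sup>2 - 1) * cos A * (sqrt (?b\<^sup>2 - 1) * cos A) + sqrt (?b\<^sup>2 - 1) * sin A * (sqrt (?b\<^sup>2 - 1) * sin A) = ?b\<^sup>2 - 1" .
  have H: "P \<in> hyperbolic_plane" "Q \<in> hyperbolic_plane" "R \<in> hyperbolic_plane"
    using gt g2 r by (auto simp: P_def Q_def R_def hyperbolic_plane_def mink_def inner_complex_def power2_eq_square)
  have m: "mink Q R = - ?a" "mink P R = - ?b" "mink P Q = - ?c"
    using law_of_cosines_cosh_side[OF pos] by (auto simp: P_def Q_def R_def mink_def inner_complex_def algebra_simps)
  have m': "mink R Q = - ?a" "mink R P = - ?b" "mink Q P = - ?c"
    using m mink_commute by metis+
  have ne: "P \<noteq> Q" "Q \<noteq> R" "R \<noteq> P"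
    using m m' gt H by (auto simp: hyperbolic_plane_def)
  show thesis
    by (rule that[OF H ne hyp_angle_from_sides[OF pos H m]
          hyp_angle_from_sides[OF _ _ _ _ H(2,3,1) m'(2,3) m(1)]
          hyp_angle_from_sides[OF _ _ _ _ H(3,1,2) m(3) m'(1,2)]]) (use pos in auto)
qed

section \<open>The prism volume and its concavity\<close>

text \<open>
  The seven arguments that belong to the triangle \<open>t\<close> are indexed by \<open>Inl i\<close> for the angle at corner
  \<open>i\<close>, by \<open>Inr None\<close> for \<open>h\<close>, and by \<open>Inr (Some i)\<close> for \<open>h\<close> plus that angle.  They depend affinely
  on the angles; this is the linear part, and so the rate of change along \<open>d\<close>.
\<close>
fun prism_form :: "real^('f::finite \<times> 3) \<Rightarrow> 'f \<times> (3 + 3 option) \<Rightarrow> real" where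
  "prism_form d (t, Inl i) = d $ (t, i)"
| "prism_form d (t, Inr None) = - angle_sum d t / 2"
| "prism_form d (t, Inr (Some i)) = d $ (t, i) - angle_sum d t / 2"

definition prism_angle :: "real^('f::finite \<times> 3) \<Rightarrow> 'f \<times> (3 + 3 option) \<Rightarrow> real" where
  "prism_angle x k = prism_form x k + (case snd k of Inl _ \<Rightarrow> 0 | Inr _ \<Rightarrow> pi / 2)"

definition prism_volume :: "real^('f::finite \<times> 3) \<Rightarrow> real" where
  "prism_volume x = (\<Sum>k\<in>UNIV. lobachevsky (prism_angle x k))"

definition prism_volume_deriv :: "real^('f::finite \<times> 3) \<Rightarrow> real^('f \<times> 3) \<Rightarrow> real" where
  "prism_volume_deriv x d = - (\<Sum>k\<in>UNIV. prism_form d k * ln (sin (prism_angle x k)))"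

definition hyperbolic :: "real^('f::finite \<times> 3) \<Rightarrow> bool" where
  "hyperbolic x \<longleftrightarrow> (\<forall>s. 0 < x $ s) \<and> (\<forall>t. angle_sum x t < pi)"

text \<open>
  The closure of the set of hyperbolic points.
\<close>
definition weakly_hyperbolic :: "real^('f::finite \<times> 3) \<Rightarrow> bool" where
  "weakly_hyperbolic x \<longleftrightarrow> (\<forall>s. 0 \<le> x $ s) \<and> (\<forall>t. angle_sum x t \<le> pi)"

lemma angle_sum_eq: "angle_sum x t = x $ (t, i) + x $ (t, i + 1) + x $ (t, i + 2)"
  unfolding angle_sum_def by (rule sum_three)

lemma angle_sum_linear: "angle_sum (x + c *\<^sub>R y) t = angle_sum x t + c * angle_sum y t"
  by (simp add: angle_sum_def sum.distrib sum_distrib_left)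

lemma prism_cases:
  obtains t i where "k = (t, Inl i)" | t where "k = (t, Inr None)" | t i where "k = (t, Inr (Some i))"
  by (metis option.exhaust sum.exhaust surj_pair)

lemma prism_angle_simps [simp]:
  "prism_angle x (t, Inl i) = x $ (t, i)"
  "prism_angle x (t, Inr None) = (pi - angle_sum x t) / 2"
  "prism_angle x (t, Inr (Some i)) = (pi - angle_sum x t) / 2 + x $ (t, i)"
  by (simp_all add: prism_angle_def field_simps)

lemma prism_form_linear: "prism_form (x + c *\<^sub>R y) k = prism_form x k + c * prism_form y k"
  by (cases k rule: prism_cases) (simp_all add: angle_sum_linear field_simps)

lemma prism_angle_line: "prism_angle (x + c *\<^sub>R y) k = prism_angle x k + c * prism_form y k"
  by (simp add: prism_angle_def prism_form_linear)

lemma prism_form_diff: "prism_form (x - y) k = prism_angle x k - prism_angle y k"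
  using prism_angle_line[of y 1 "x - y" k] by simp

lemma sum_prism:
  fixes f :: "'f::finite \<times> (3 + 3 option) \<Rightarrow> real"
  shows "(\<Sum>k\<in>UNIV. f k) = (\<Sum>t\<in>UNIV. \<Sum>m\<in>UNIV. f (t, m))"
  by (simp add: sum.cartesian_product UNIV_Times_UNIV)

lemma sum_seven:
  fixes f :: "3 + 3 option \<Rightarrow> real"
  shows "(\<Sum>m\<in>UNIV. f m) = f (Inl i) + f (Inl (i + 1)) + f (Inl (i + 2)) + f (Inr None)
     + (f (Inr (Some i)) + f (Inr (Some (i + 1))) + f (Inr (Some (i + 2))))"
proof -
  have "(\<Sum>m\<in>UNIV. f m) = (\<Sum>j\<in>UNIV. f (Inl j)) + (\<Sum>o'\<in>UNIV. f (Inr o'))"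
    by (simp add: UNIV_Plus_UNIV[symmetric] sum.Plus del: UNIV_Plus_UNIV)
  also have "(\<Sum>o'\<in>UNIV. f (Inr o')) = f (Inr None) + (\<Sum>j\<in>UNIV. f (Inr (Some j)))"
    by (simp add: UNIV_option_conv sum.reindex)
  finally show ?thesis by (simp add: sum_three[of _ i])
qed

text \<open>
  So the hyperbolic points are described by finitely many strict affine inequalities, which makes
  convexity and openness immediate.
\<close>
lemma hyperbolic_iff: "hyperbolic x \<longleftrightarrow> (\<forall>k. 0 < prism_angle x k)"
proof
  assume "hyperbolic x"
  then show "\<forall>k. 0 < prism_angle x k"
    by (intro allI, rule_tac k = k in prism_cases) (auto simp: hyperbolic_def add_pos_pos)
next
  assume *: "\<forall>k. 0 < prism_angle x k"
  have "0 < x $ s" for s using *[rule_format, of "(fst s, Inl (snd s))"] by simp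
  moreover have "angle_sum x t < pi" for t using *[rule_format, of "(t, Inr None)"] by simp
  ultimately show "hyperbolic x" by (simp add: hyperbolic_def)
qed

lemma weakly_hyperbolic_prism_angle:
  assumes "weakly_hyperbolic x"
  shows "0 \<le> prism_angle x k \<and> prism_angle x k \<le> pi"
proof -
  have pos: "0 \<le> x $ s" for s using assms unfolding weakly_hyperbolic_def by blast
  have sum: "x $ (t, i) + x $ (t, i + 1) + x $ (t, i + 2) \<le> pi" for t i
    using assms unfolding weakly_hyperbolic_def angle_sum_eq[of x _ i] by blast
  show ?thesis
  proof (cases k rule: prism_cases)
    case (1 t i)
    then show ?thesis using sum[of t i] pos[of "(t, i)"] pos[of "(t, i + 1)"] pos[of "(t, i + 2)"] by simp
  next
    case (2 t)
    then show ?thesis using sum[of t 0] pos[of "(t, 0)"] pos[of "(t, 0 + 1)"] pos[of "(t, 0 + 2)"]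
      by (simp add: angle_sum_eq[of x t 0])
  next
    case (3 t i)
    then show ?thesis using sum[of t i] pos[of "(t, i)"] pos[of "(t, i + 1)"] pos[of "(t, i + 2)"]
      by (simp add: angle_sum_eq[of x t i] field_simps)
  qed
qed

lemma hyperbolic_imp_weakly: "hyperbolic x \<Longrightarrow> weakly_hyperbolic x"
  by (simp add: hyperbolic_def weakly_hyperbolic_def less_imp_le)

text \<open>
  An argument reaches \<open>pi\<close> only in the degenerate triangle \<open>0, 0, pi\<close>.  So this case, in which
  derivatives of the volume may diverge with the wrong sign, is confined to illegal triangles; it also
  shows that all arguments are less than \<open>pi\<close> at hyperbolic points.
\<close>
lemma prism_angle_eq_pi:
  assumes x: "weakly_hyperbolic x" and pi: "prism_angle x (t, m) = pi"
  obtains i where "x $ (t, i) = pi" "x $ (t, i + 1) = 0" "x $ (t, i + 2) = 0"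
proof -
  have pos: "0 \<le> x $ s" for s using x unfolding weakly_hyperbolic_def by blast
  have sum: "x $ (t, i) + x $ (t, i + 1) + x $ (t, i + 2) \<le> pi" for i
    using x unfolding weakly_hyperbolic_def angle_sum_eq[of x _ i] by blast
  have pos3: "0 \<le> x $ (t, i)" "0 \<le> x $ (t, i + 1)" "0 \<le> x $ (t, i + 2)" for i by (rule pos)+
  have as: "angle_sum x t = x $ (t, i) + x $ (t, i + 1) + x $ (t, i + 2)" for i by (rule angle_sum_eq)
  consider i where "m = Inl i" | "m = Inr None" | i where "m = Inr (Some i)"
    by (metis option.exhaust sum.exhaust)
  then show thesis
  proof cases
    case (1 i)
    then have "x $ (t, i) = pi" using pi by simp
    then show thesis using sum[of i] pos3[of i] by (intro that[of i]) linarith+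
  next
    case 2
    then have "pi - angle_sum x t = 2 * pi" using pi by simp
    then show thesis using pos3[of 0] as[of 0] pi_gt_zero by linarith
  next
    case (3 i)
    then have "pi - angle_sum x t + 2 * x $ (t, i) = 2 * pi" using pi by (simp add: field_simps)
    then show thesis using sum[of i] pos3[of i] as[of i] by (intro that[of i]) linarith+
  qed
qed

lemma hyperbolic_prism_angle:
  assumes "hyperbolic x"
  shows "0 < prism_angle x k \<and> prism_angle x k < pi"
proof -
  have "prism_angle x k \<noteq> pi"
    using prism_angle_eq_pi[OF hyperbolic_imp_weakly[OF assms], of "fst k" "snd k"] assms
    by (metis hyperbolic_def less_irrefl prod.collapse)
  moreover have "0 < prism_angle x k" using assms hyperbolic_iff by blast
  ultimately show ?thesis
    using weakly_hyperbolic_prism_angle[OF hyperbolic_imp_weakly[OF assms], of k] by linarith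
qed

lemma hyperbolic_between:
  assumes "weakly_hyperbolic y" "hyperbolic x" "0 < s" "s \<le> 1"
  shows "hyperbolic (y + s *\<^sub>R (x - y))"
proof -
  have "0 < prism_angle (y + s *\<^sub>R (x - y)) k" for k
  proof -
    have "prism_angle (y + s *\<^sub>R (x - y)) k = (1 - s) * prism_angle y k + s * prism_angle x k"
      unfolding prism_angle_line prism_form_diff by (simp add: algebra_simps)
    also have "\<dots> > 0"
      using assms weakly_hyperbolic_prism_angle[of y k] hyperbolic_prism_angle[of x k]
      by (intro add_nonneg_pos) auto
    finally show ?thesis .
  qed
  then show ?thesis by (simp add: hyperbolic_iff)
qed

lemma prism_volume_has_derivative:
  assumes "hyperbolic (x + s *\<^sub>R d)"
  shows "((\<lambda>s. prism_volume (x + s *\<^sub>R d)) has_real_derivative prism_volume_deriv (x + s *\<^sub>R d) d) (at s)"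
proof -
  have "((\<lambda>s. lobachevsky (prism_angle x k + s * prism_form d k)) has_real_derivative
      - ln (sin (prism_angle x k + s * prism_form d k)) * prism_form d k) (at s)" for k
  proof (rule DERIV_chain2[of lobachevsky])
    show "(lobachevsky has_real_derivative - ln (sin (prism_angle x k + s * prism_form d k)))
      (at (prism_angle x k + s * prism_form d k))"
      using hyperbolic_prism_angle[OF assms, of k] unfolding prism_angle_line by (intro lobachevsky_deriv) auto
  qed (auto intro!: derivative_eq_intros)
  then have "((\<lambda>s. \<Sum>k\<in>UNIV. lobachevsky (prism_angle x k + s * prism_form d k)) has_real_derivative
      (\<Sum>k\<in>UNIV. - ln (sin (prism_angle x k + s * prism_form d k)) * prism_form d k)) (at s)"
    by (intro DERIV_sum) auto
  then show ?thesis
    by (simp add: prism_volume_def prism_volume_deriv_def prism_angle_line sum_negf mult.commute)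
qed

lemma prism_volume_deriv_linear: "prism_volume_deriv x (c + s *\<^sub>R d) = prism_volume_deriv x c + s * prism_volume_deriv x d"
  by (simp add: prism_volume_deriv_def prism_form_linear algebra_simps sum.distrib sum_distrib_left)

lemma prism_volume_hessian_posdef:
  assumes x: "hyperbolic x" and d: "d \<noteq> 0"
  shows "0 < (\<Sum>k\<in>UNIV. (prism_form d k)\<^sup>2 * cot (prism_angle x k))"
proof -
  define q where "q = (\<lambda>t. \<Sum>m\<in>UNIV. (prism_form d (t, m))\<^sup>2 * cot (prism_angle x (t, m)))"
  have *: "0 \<le> q t" "q t \<le> 0 \<Longrightarrow> d $ (t, i) = 0" for t i
  proof -
    have pos: "0 < x $ (t, 1)" "0 < x $ (t, 1 + 1)" "0 < x $ (t, 1 + 2)" "0 < (pi - angle_sum x t) / 2"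
      using x by (simp_all add: hyperbolic_def)
    have sx: "2 * ((pi - angle_sum x t) / 2) + x $ (t, 1) + x $ (t, 1 + 1) + x $ (t, 1 + 2) = pi"
      using angle_sum_eq[of x t 1] by (simp add: field_simps)
    have sd: "2 * (- angle_sum d t / 2) + d $ (t, 1) + d $ (t, 1 + 1) + d $ (t, 1 + 2) = 0"
      using angle_sum_eq[of d t 1] by (simp add: field_simps)
    note Q = prism_hessian_posdef[OF pos sx sd]
    have qe: "q t = cot (x $ (t, 1)) * (d $ (t, 1))\<^sup>2 + cot (x $ (t, 1 + 1)) * (d $ (t, 1 + 1))\<^sup>2
      + cot (x $ (t, 1 + 2)) * (d $ (t, 1 + 2))\<^sup>2
      + cot ((pi - angle_sum x t) / 2) * (- angle_sum d t / 2)\<^sup>2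
      + (cot ((pi - angle_sum x t) / 2 + x $ (t, 1)) * (- angle_sum d t / 2 + d $ (t, 1))\<^sup>2
       + cot ((pi - angle_sum x t) / 2 + x $ (t, 1 + 1)) * (- angle_sum d t / 2 + d $ (t, 1 + 1))\<^sup>2
       + cot ((pi - angle_sum x t) / 2 + x $ (t, 1 + 2)) * (- angle_sum d t / 2 + d $ (t, 1 + 2))\<^sup>2)"
      unfolding q_def sum_seven[of _ 1] prism_form.simps prism_angle_simps by (simp only: mult.commute uminus_add_conv_diff minus_divide_left[symmetric])
    show "0 \<le> q t" unfolding qe by (rule Q(1))
    assume "q t \<le> 0"
    then have "d $ (t, 1) = 0 \<and> d $ (t, 1 + 1) = 0 \<and> d $ (t, 1 + 2) = 0" unfolding qe by (rule Q(2))
    then show "d $ (t, i) = 0" using UNIV_three[of 1] by (metis UNIV_I insertE singletonD)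
  qed
  obtain s where "d $ s \<noteq> 0" using d by (auto simp: vec_eq_iff)
  then have "0 < q (fst s)" using *(1)[of "fst s"] *(2)[of "fst s" "snd s"] by force
  then have "0 < (\<Sum>t\<in>UNIV. q t)" using *(1) by (intro sum_pos2[of _ "fst s"]) auto
  then show ?thesis by (simp add: sum_prism q_def)
qed

text \<open>
  Strict concavity in the form used for uniqueness: the derivative in the direction \<open>v - u\<close> decreases
  on the way from \<open>u\<close> to \<open>v\<close>, so it cannot vanish at both ends.
\<close>
lemma prism_volume_strictly_concave:
  assumes u: "hyperbolic u" and v: "hyperbolic v" and ne: "u \<noteq> v"
  shows "prism_volume_deriv v (v - u) < prism_volume_deriv u (v - u)"
proof -
  define d where "d = v - u"
  have h: "hyperbolic (u + s *\<^sub>R d)" if "0 \<le> s" "s \<le> 1" for s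
    using that u v hyperbolic_between[OF hyperbolic_imp_weakly[OF u] v, of s]
    by (cases "s = 0") (auto simp: d_def)
  have "prism_volume_deriv (u + 1 *\<^sub>R d) d < prism_volume_deriv (u + 0 *\<^sub>R d) d"
  proof (rule DERIV_neg_imp_decreasing[of 0 1 "\<lambda>s. prism_volume_deriv (u + s *\<^sub>R d) d"])
    fix s :: real assume s: "0 \<le> s" "s \<le> 1"
    have "((\<lambda>s. prism_form d k * ln (sin (prism_angle u k + s * prism_form d k))) has_real_derivative
       (prism_form d k)\<^sup>2 * cot (prism_angle u k + s * prism_form d k)) (at s)" for k
    proof -
      have "sin (prism_angle u k + s * prism_form d k) > 0"
        using hyperbolic_prism_angle[OF h[OF s], of k] unfolding prism_angle_line by (intro sin_gt_zero) auto
      then show ?thesis by (auto intro!: derivative_eq_intros simp: cot_def power2_eq_square)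
    qed
    then have "((\<lambda>s. - (\<Sum>k\<in>UNIV. prism_form d k * ln (sin (prism_angle u k + s * prism_form d k)))) has_real_derivative
       - (\<Sum>k\<in>UNIV. (prism_form d k)\<^sup>2 * cot (prism_angle u k + s * prism_form d k))) (at s)"
      by (intro DERIV_minus DERIV_sum) auto
    then have "((\<lambda>s. prism_volume_deriv (u + s *\<^sub>R d) d) has_real_derivative
       - (\<Sum>k\<in>UNIV. (prism_form d k)\<^sup>2 * cot (prism_angle (u + s *\<^sub>R d) k))) (at s)"
      by (simp add: prism_volume_deriv_def prism_angle_line)
    moreover have "d \<noteq> 0" using ne by (simp add: d_def)
    ultimately show "\<exists>y. ((\<lambda>s. prism_volume_deriv (u + s *\<^sub>R d) d) has_real_derivative y) (at s) \<and> y < 0"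
      using prism_volume_hessian_posdef[OF h[OF s]] by (meson neg_less_0_iff_less)
  qed simp
  then show ?thesis by (simp add: d_def)
qed

section \<open>The gradient of the volume and the side lengths\<close>

definition cosh_length :: "real^('f::finite \<times> 3) \<Rightarrow> 'f \<times> 3 \<Rightarrow> real" where
  "cosh_length x s = cosh_side (x $ s) (x $ (fst s, snd s + 1)) (x $ (fst s, snd s + 2))"

lemma hyperbolic_triangle:
  assumes "hyperbolic x"
  shows "0 < x $ (t, i)" "x $ (t, i) + x $ (t, i + 1) + x $ (t, i + 2) < pi"
  using assms by (auto simp: hyperbolic_def angle_sum_eq[symmetric])

lemma one_less_cosh_length: "hyperbolic x \<Longrightarrow> 1 < cosh_length x s"
  using hyperbolic_triangle[of x "fst s"] unfolding cosh_length_def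
  by (intro one_less_cosh_side) (metis prod.collapse)+

text \<open>
  Along \<open>side_vector (t, i)\<close> the angles \<open>B\<close> and \<open>C\<close> grow at unit speed, \<open>h\<close> and \<open>h + A\<close> fall at unit
  speed, and the other arguments are stationary.  Hence the derivative is
  \<open>ln (sin h sin (h + A) / (sin B sin C))\<close>, and
  \<open>2 sin h sin (h + A) = cos A + cos (B + C)\<close>.
\<close>
lemma prism_volume_deriv_side_vector:
  assumes x: "hyperbolic x"
  shows "prism_volume_deriv x (side_vector s) = ln ((cosh_length x s - 1) / 2)"
proof -
  obtain t i where s: "s = (t, i)" by (cases s)
  define A B C h where "A = x $ (t, i)" and "B = x $ (t, i + 1)" and "C = x $ (t, i + 2)"
    and "h = (pi - angle_sum x t) / 2"
  have pos: "0 < A" "0 < B" "0 < C" "0 < h" using x by (simp_all add: hyperbolic_def A_def B_def C_def h_def)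
  have sum: "2 * h + A + B + C = pi" using angle_sum_eq[of x t i] by (simp add: h_def A_def B_def C_def field_simps)
  have sp: "sin B > 0" "sin C > 0" "sin h > 0" "sin (h + A) > 0"
    using pos sum by (auto intro!: sin_gt_zero)
  have sv: "side_vector s $ (t', j) = (if t' = t \<and> (j = i + 1 \<or> j = i + 2) then 1 else 0)" for t' j
    by (auto simp: side_vector_def s axis_def)
  have as: "angle_sum (side_vector s) t' = (if t' = t then 2 else 0)" for t'
    by (simp add: angle_sum_eq[of _ t' i] sv)
  have z: "prism_form (side_vector s) (t', m) = 0" if "t' \<noteq> t" for t' m
    using that by (cases "(t', m)" rule: prism_cases) (auto simp: sv as)
  have "(\<Sum>k\<in>UNIV. prism_form (side_vector s) k * ln (sin (prism_angle x k)))
     = (\<Sum>t'\<in>{t}. \<Sum>m\<in>UNIV. prism_form (side_vector s) (t', m) * ln (sin (prism_angle x (t', m))))"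
    unfolding sum_prism by (rule sum.mono_neutral_right) (auto simp: z)
  also have "\<dots> = ln (sin B) + ln (sin C) - ln (sin h) - ln (sin (h + A))"
    by (simp add: sum_seven[of _ i] sv as A_def B_def C_def h_def)
  finally have "prism_volume_deriv x (side_vector s) = ln (sin h) + ln (sin (h + A)) - (ln (sin B) + ln (sin C))"
    by (simp add: prism_volume_deriv_def)
  also have "\<dots> = ln (sin h * sin (h + A) / (sin B * sin C))"
    using sp by (simp add: ln_mult ln_div)
  also have "sin h * sin (h + A) = (cos A + cos (B + C)) / 2"
  proof -
    have "h + (h + A) = pi - (B + C)" using sum by simp
    then have "cos (h + (h + A)) = - cos (B + C)" by (metis cos_pi_minus)
    then show ?thesis by (simp add: sin_times_sin)
  qed
  also have "(cos A + cos (B + C)) / 2 / (sin B * sin C) = (cosh_length x s - 1) / 2"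
    using sp by (simp add: cosh_length_def cosh_side_def s A_def B_def C_def cos_add field_simps)
  finally show ?thesis .
qed

text \<open>
  Existence of a triangle with the given angles and the dual law of cosines show that the definite
  description in \<open>side_length\<close> denotes.
\<close>
lemma side_length_eq:
  assumes x: "hyperbolic x"
  shows "side_length x s = arcosh (cosh_length x s)"
proof -
  obtain t i where s: "s = (t, i)" by (cases s)
  define A B C where "A = x $ (t, i)" and "B = x $ (t, i + 1)" and "C = x $ (t, i + 2)"
  have pos: "0 < A" "0 < B" "0 < C" "A + B + C < pi"
    using hyperbolic_triangle[OF x] by (simp_all add: A_def B_def C_def)
  have sinB: "sin B \<noteq> 0" using pos sin_gt_zero[of B] by auto
  have law: "hyp_dist (P (i + 1)) (P (i + 2)) = arcosh (cosh_length x s)"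
    if "realizes P (\<lambda>j. x $ (t, j))" for P
  proof -
    have H: "P j \<in> hyperbolic_plane" for j using that by (auto simp: realizes_def)
    have ne: "P i \<noteq> P (i + 1)" "P (i + 1) \<noteq> P (i + 2)" "P (i + 2) \<noteq> P i"
      using that by (auto simp: realizes_def inj_eq)
    have a: "x $ (t, j) = hyp_angle (P j) (P (j + 1)) (P (j + 2))" for j
      using that by (simp add: realizes_def)
    have "- mink (P (i + 1)) (P (i + 2)) = cosh_side A B C"
      by (rule dual_law_of_cosines[OF H H H ne _ _ _ sinB]) (simp_all add: A_def B_def C_def a)
    then show ?thesis by (simp add: hyp_dist_def cosh_length_def s A_def B_def C_def)
  qed
  obtain P Q R where PQR: "P \<in> hyperbolic_plane" "Q \<in> hyperbolic_plane" "R \<in> hyperbolic_plane"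
    "P \<noteq> Q" "Q \<noteq> R" "R \<noteq> P"
    "hyp_angle P Q R = A" "hyp_angle Q R P = B" "hyp_angle R P Q = C"
    by (rule hyperbolic_triangle_exists[OF pos])
  define T where "T = (\<lambda>j. if j = i then P else if j = i + 1 then Q else R)"
  have T: "T i = P" "T (i + 1) = Q" "T (i + 2) = R" by (simp_all add: T_def)
  have "realizes T (\<lambda>j. x $ (t, j))"
    unfolding realizes_def inj_def all_three[of _ i] image_subset_iff Ball_def
    using PQR by (simp add: all_three[of _ i] T A_def B_def C_def)
  then show ?thesis
    unfolding side_length_def s fst_conv snd_conv
    using law[unfolded s] by (intro the_equality) auto
qed

lemma side_length_eq_iff:
  assumes "hyperbolic x"
  shows "side_length x s = side_length x s' \<longleftrightarrow>
    prism_volume_deriv x (side_vector s - side_vector s') = 0"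
proof -
  have gt: "1 < cosh_length x s" "1 < cosh_length x s'"
    using one_less_cosh_length[OF assms] by blast+
  have "side_length x s = side_length x s' \<longleftrightarrow> cosh_length x s = cosh_length x s'"
    unfolding side_length_eq[OF assms] using gt by (metis cosh_arcosh_real less_imp_le)
  moreover have "prism_volume_deriv x (side_vector s - side_vector s')
      = ln ((cosh_length x s - 1) / 2) - ln ((cosh_length x s' - 1) / 2)"
    using prism_volume_deriv_linear[of x "side_vector s" "-1" "side_vector s'"]
    by (simp add: prism_volume_deriv_side_vector[OF assms])
  ultimately show ?thesis using gt by simp
qed

section \<open>Maxima of the volume\<close>

text \<open>
  If some argument is \<open>pi\<close>, the angles are \<open>0, 0, pi\<close> and all seven arguments are \<open>0\<close> or \<open>pi\<close>; since
  they always add up to \<open>2 pi\<close>, their rates add up to \<open>0\<close>.  Otherwise only arguments equal to \<open>0\<close>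
  count; they increase towards an interior point, and being legal means that there is one.
\<close>
lemma boundary_coefficient:
  fixes x y :: "real^('f::finite \<times> 3)"
  assumes x: "hyperbolic x" and y: "weakly_hyperbolic y"
  defines "\<kappa> \<equiv> \<lambda>t. \<Sum>m\<in>UNIV. if prism_angle y (t, m) = 0 \<or> prism_angle y (t, m) = pi
                              then prism_form (x - y) (t, m) else 0"
  shows "0 \<le> \<kappa> t" and "legal y t \<Longrightarrow> 0 < \<kappa> t"
proof -
  let ?g = "\<lambda>m. if prism_angle y (t, m) = 0 \<or> prism_angle y (t, m) = pi
                              then prism_form (x - y) (t, m) else 0"
  have "0 \<le> \<kappa> t \<and> (legal y t \<longrightarrow> 0 < \<kappa> t)"
  proof (cases "\<exists>m. prism_angle y (t, m) = pi")
    case True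
    then obtain i where i: "y $ (t, i) = pi" "y $ (t, i + 1) = 0" "y $ (t, i + 2) = 0"
      using prism_angle_eq_pi[OF y] by metis
    have as: "angle_sum y t = pi" by (simp add: angle_sum_eq[of y t i] i)
    have "\<kappa> t = 0"
      using angle_sum_eq[of "x - y" t i] unfolding \<kappa>_def sum_seven[of _ i] by (simp add: i as) (simp add: field_simps)
    moreover have "mset_set UNIV = {#i, i + 1, i + 2#}"
      by (subst UNIV_three[of i]) simp
    then have "angles y t = {#0, 0, pi#}"
      unfolding angles_def by (simp add: i add_mset_commute)
    ultimately show ?thesis by (simp add: legal_def)
  next
    case False
    have nn: "0 \<le> ?g m" for m
    proof -
      have "prism_angle y (t, m) \<noteq> pi" using False by blast
      moreover have "0 < prism_angle x (t, m)" using hyperbolic_prism_angle[OF x] by blast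
      ultimately show ?thesis by (simp add: prism_form_diff)
    qed
    have "0 < \<kappa> t" if "legal y t"
    proof -
      have "\<exists>m. prism_angle y (t, m) = 0"
      proof (cases "curvature y t = 0")
        case True
        then have "prism_angle y (t, Inr None) = 0" by (simp add: curvature_def)
        then show ?thesis ..
      next
        case False
        then have "0 \<in># angles y t" using that by (simp add: legal_def)
        then obtain i where "y $ (t, i) = 0" by (auto simp: angles_def)
        then have "prism_angle y (t, Inl i) = 0" by simp
        then show ?thesis ..
      qed
      then obtain m where m: "prism_angle y (t, m) = 0" ..
      have "0 < ?g m" using m hyperbolic_prism_angle[OF x, of "(t, m)"] by (simp add: prism_form_diff)
      then show ?thesis unfolding \<kappa>_def by (rule sum_pos2[OF finite_class.finite_UNIV UNIV_I _ nn])
    qed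
    moreover have "0 \<le> \<kappa> t" unfolding \<kappa>_def by (intro sum_nonneg nn)
    ultimately show ?thesis by blast
  qed
  then show "0 \<le> \<kappa> t" "legal y t \<Longrightarrow> 0 < \<kappa> t" by auto
qed

lemma prism_volume_continuous: "continuous_on {y. weakly_hyperbolic y} prism_volume"
proof -
  have "continuous_on A (\<lambda>y. prism_angle y k)" for A k
    by (cases k rule: prism_cases) (simp_all add: angle_sum_def continuous_intros)
  moreover have "(\<lambda>y. prism_angle y k) ` {y. weakly_hyperbolic y} \<subseteq> {0..pi}" for k
    by (simp add: image_subset_iff weakly_hyperbolic_prism_angle)
  ultimately show ?thesis
    unfolding prism_volume_def by (intro continuous_on_sum continuous_on_compose2[OF lobachevsky_continuous])
qed

text \<open>
  By the sign of the boundary coefficients, the derivative tends to infinity at the start of the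
  segment from \<open>y\<close> to \<open>x\<close>.  The volume is continuous there, so it increases strictly.
\<close>
lemma prism_volume_increases_off_boundary:
  assumes x: "hyperbolic x" and y: "weakly_hyperbolic y" and leg: "legal y t"
  obtains s where "0 < s" "s < 1" "prism_volume y < prism_volume (y + s *\<^sub>R (x - y))"
proof -
  define d where "d = x - y"
  let ?E = "\<lambda>k. prism_angle y k = 0 \<or> prism_angle y k = pi"
  have "0 < (\<Sum>t\<in>UNIV. \<Sum>m\<in>UNIV. if prism_angle y (t, m) = 0 \<or> prism_angle y (t, m) = pi
                              then prism_form d (t, m) else 0)"
    using boundary_coefficient[OF x y] leg unfolding d_def by (intro sum_pos2[of _ t]) auto
  also have "\<dots> = (\<Sum>k\<in>UNIV. if ?E k then prism_form d k else 0)"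
    by (rule sum_prism[symmetric])
  also have "\<dots> = (\<Sum>k | ?E k. prism_form d k)"
    using sum.inter_filter[of UNIV "prism_form d" ?E] by simp
  finally have "0 < (\<Sum>k | ?E k. prism_form d k)" .
  then have "filterlim (\<lambda>s. prism_volume_deriv (y + s *\<^sub>R d) d) at_top (at_right 0)"
    unfolding prism_volume_deriv_def prism_angle_line
    using weakly_hyperbolic_prism_angle[OF y] hyperbolic_prism_angle[OF x]
    by (intro deriv_log_sine_sum_at_top) (auto simp: d_def prism_form_diff)
  then have "\<forall>\<^sub>F s in at_right 0. 0 < prism_volume_deriv (y + s *\<^sub>R d) d"
    by (auto simp: filterlim_at_top_dense)
  then obtain b where b: "0 < b" "\<And>s. 0 < s \<Longrightarrow> s < b \<Longrightarrow> 0 < prism_volume_deriv (y + s *\<^sub>R d) d"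
    by (auto simp: eventually_at_right_field)
  \<comment> \<open>A step size within the range where the derivative is positive and below 1, so that the
    path stays on the segment to \<open>x\<close>.\<close>
  define e where "e = min b 1 / 2"
  have e: "0 < e" "e < b" "e < 1" using b(1) by (auto simp: e_def min_def)
  have h: "hyperbolic (y + s *\<^sub>R d)" if "0 < s" "s \<le> 1" for s
    using hyperbolic_between[OF y x that] by (simp add: d_def)
  have w: "weakly_hyperbolic (y + s *\<^sub>R d)" if "0 \<le> s" "s \<le> 1" for s
    using h[of s] hyperbolic_imp_weakly y that by (cases "s = 0") auto
  have "prism_volume (y + 0 *\<^sub>R d) < prism_volume (y + e *\<^sub>R d)"
  proof (rule DERIV_pos_imp_increasing_open[OF e(1), of "\<lambda>s. prism_volume (y + s *\<^sub>R d)"])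
    show "\<exists>z. ((\<lambda>s. prism_volume (y + s *\<^sub>R d)) has_real_derivative z) (at s) \<and> 0 < z" if "0 < s" "s < e" for s
      using prism_volume_has_derivative[OF h, of s] b(2)[of s] that e by auto
    show "continuous_on {0..e} (\<lambda>s. prism_volume (y + s *\<^sub>R d))"
      by (rule continuous_on_compose2[OF prism_volume_continuous]) (use w e in \<open>auto intro!: continuous_intros\<close>)
  qed
  then show thesis using that[of e] e by (simp add: d_def)
qed

lemma compact_weakly_hyperbolic: "compact {y :: real^('f::finite \<times> 3). weakly_hyperbolic y}"
proof -
  have "{y :: real^('f \<times> 3). weakly_hyperbolic y} = (\<Inter>s. {y. 0 \<le> y $ s}) \<inter> (\<Inter>t. {y. angle_sum y t \<le> pi})"
    by (auto simp: weakly_hyperbolic_def)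
  also have "closed \<dots>"
    unfolding angle_sum_def
    by (intro closed_Int closed_INT ballI closed_Collect_le continuous_intros)
  finally have "closed {y :: real^('f \<times> 3). weakly_hyperbolic y}" .
  moreover have "norm y \<le> (\<Sum>s\<in>(UNIV :: ('f \<times> 3) set). pi)" if y: "weakly_hyperbolic y" for y :: "real^('f \<times> 3)"
  proof -
    have "\<bar>y $ s\<bar> \<le> pi" for s
      using weakly_hyperbolic_prism_angle[OF y, of "(fst s, Inl (snd s))"] by simp
    then have "(\<Sum>s\<in>UNIV. \<bar>y $ s\<bar>) \<le> (\<Sum>s\<in>(UNIV :: ('f \<times> 3) set). pi)" by (intro sum_mono)
    then show ?thesis using norm_le_l1_cart[of y] by linarith
  qed
  then have "bounded {y :: real^('f \<times> 3). weakly_hyperbolic y}" unfolding bounded_iff by blast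
  ultimately show ?thesis by (simp add: compact_eq_bounded_closed)
qed

text \<open>
  The maximum of the volume over the compact set of weakly hyperbolic points of \<open>x + C\<close> is attained
  away from the boundary, because at a boundary point the volume increases towards \<open>x\<close>.
\<close>
lemma critical_point_exists:
  fixes x :: "real^('f::finite \<times> 3)"
  assumes C: "subspace C" and x: "hyperbolic x"
    and leg: "\<And>y. y - x \<in> C \<Longrightarrow> weakly_hyperbolic y \<Longrightarrow> \<not> hyperbolic y \<Longrightarrow> \<exists>t. legal y t"
  obtains u where "u - x \<in> C" "hyperbolic u" "\<And>c. c \<in> C \<Longrightarrow> prism_volume_deriv u c = 0"
proof -
  define K where "K = {y. weakly_hyperbolic y} \<inter> {y. y - x \<in> C}"
  have "closed {y. y - x \<in> C}"
  proof -
    have "continuous_on UNIV (\<lambda>y. y - x)" by (intro continuous_intros)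
    then show ?thesis using closed_vimage[OF closed_subspace[OF C]] by (force simp: vimage_def)
  qed
  then have "compact K" unfolding K_def by (intro compact_Int_closed compact_weakly_hyperbolic)
  moreover have "x \<in> K" using x C by (simp add: K_def hyperbolic_imp_weakly subspace_0)
  moreover have "continuous_on K prism_volume"
    by (rule continuous_on_subset[OF prism_volume_continuous]) (auto simp: K_def)
  ultimately obtain u where u: "u \<in> K" and max: "\<And>y. y \<in> K \<Longrightarrow> prism_volume y \<le> prism_volume u"
    using continuous_attains_sup[of K prism_volume] by blast
  have uw: "weakly_hyperbolic u" and uC: "u - x \<in> C" using u by (auto simp: K_def)
  have h: "hyperbolic u"
  proof (rule ccontr)
    assume "\<not> hyperbolic u"
    then obtain t where "legal u t" using leg uC uw by blast
    then obtain s where s: "0 < s" "s < 1" "prism_volume u < prism_volume (u + s *\<^sub>R (x - u))"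
      using prism_volume_increases_off_boundary[OF x uw] by blast
    have "u + s *\<^sub>R (x - u) - x = (1 - s) *\<^sub>R (u - x)" by (simp add: algebra_simps)
    then have "u + s *\<^sub>R (x - u) \<in> K"
      using hyperbolic_between[OF uw x s(1)] s uC C
      by (simp add: K_def hyperbolic_imp_weakly subspace_scale)
    then show False using max s by fastforce
  qed
  have "prism_volume_deriv u c = 0" if c: "c \<in> C" for c
  proof -
    have "\<forall>\<^sub>F s in nhds 0. 0 < prism_angle (u + s *\<^sub>R c) k" for k
    proof -
      have "((\<lambda>s. prism_angle u k + s * prism_form c k) \<longlongrightarrow> prism_angle u k + 0 * prism_form c k) (nhds 0)"
        by (intro tendsto_intros) (simp add: filterlim_ident)
      moreover have "0 < prism_angle u k" using h hyperbolic_iff by blast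
      then have "0 < prism_angle u k + 0 * prism_form c k" by simp
      ultimately show ?thesis unfolding prism_angle_line by (rule order_tendstoD(1))
    qed
    then have "\<forall>\<^sub>F s in nhds 0. hyperbolic (u + s *\<^sub>R c)"
      unfolding hyperbolic_iff by (rule eventually_all_finite)
    then obtain \<delta> where \<delta>: "0 < \<delta>" "\<And>s::real. \<bar>s\<bar> < \<delta> \<Longrightarrow> hyperbolic (u + s *\<^sub>R c)"
      by (auto simp: eventually_nhds_metric dist_real_def)
    have "u + s *\<^sub>R c - x \<in> C" for s
      using subspace_add[OF C uC subspace_scale[OF C c]] by (simp add: algebra_simps)
    then have "prism_volume (u + s *\<^sub>R c) \<le> prism_volume (u + 0 *\<^sub>R c)" if "\<bar>0 - s\<bar> < \<delta>" for s
      using max[of "u + s *\<^sub>R c"] \<delta>(2)[of s] that by (simp add: K_def hyperbolic_imp_weakly)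
    moreover have "((\<lambda>s. prism_volume (u + s *\<^sub>R c)) has_real_derivative prism_volume_deriv u c) (at 0)"
      using prism_volume_has_derivative[of u 0 c] h by simp
    ultimately show ?thesis using DERIV_local_max[OF _ \<delta>(1)] by blast
  qed
  then show thesis using that uC h by blast
qed

section \<open>Conformal changes and the vertex equations\<close>

lemma open_face_singleton: "open_face {j} = {corner j}"
proof -
  have "b = corner j" if b: "b \<in> open_face {j}" for b
  proof -
    have z: "b $ i = 0" if "i \<noteq> j" for i using b that by (force simp: open_face_def std_triangle_def less_le)
    have "(\<Sum>i\<in>UNIV. b $ i) = 1" using b by (simp add: open_face_def std_triangle_def)
    then have "b $ j = 1" by (simp add: sum_three[of _ j] z)
    then show ?thesis using z by (auto simp: vec_eq_iff corner_def axis_def)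
  qed
  moreover have "corner j \<in> open_face {j}"
    by (auto simp: open_face_def std_triangle_def corner_def axis_def sum_three[of _ j])
  ultimately show ?thesis by blast
qed

lemma face_edge: "face (- {i}) = open_face (- {i}) \<union> {corner (i + 1), corner (i + 2)}"
proof -
  have "b \<in> open_face (- {i}) \<union> {corner (i + 1), corner (i + 2)}" if b: "b \<in> face (- {i})" for b
  proof -
    have ge: "0 \<le> b $ j" and st: "b \<in> std_triangle" and zi: "b $ i = 0" for j
      using b by (auto simp: face_def std_triangle_def)
    have one: "b $ (i + 1) + b $ (i + 2) = 1"
      using st sum_three[of "\<lambda>j. b $ j" i] zi by (simp add: std_triangle_def)
    consider "b $ (i + 1) = 0" | "b $ (i + 2) = 0" | "0 < b $ (i + 1)" "0 < b $ (i + 2)"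
      using ge[of "i + 1"] ge[of "i + 2"] by linarith
    then show ?thesis
    proof cases
      case 1
      then have "b = corner (i + 2)" using one zi by (simp add: vec_eq_iff all_three[of _ i] corner_def axis_def)
      then show ?thesis by simp
    next
      case 2
      then have "b = corner (i + 1)" using one zi by (simp add: vec_eq_iff all_three[of _ i] corner_def axis_def)
      then show ?thesis by simp
    next
      case 3
      then have "b \<in> open_face (- {i})" using st zi by (simp add: open_face_def all_three[of _ i])
      then show ?thesis by simp
    qed
  qed
  moreover have "open_face (- {i}) \<subseteq> face (- {i})"
    by (auto simp: open_face_def face_def std_triangle_def less_le)
  moreover have "corner (i + 1) \<in> face (- {i})" "corner (i + 2) \<in> face (- {i})"
    by (auto simp: face_def std_triangle_def corner_def axis_def sum_three[of _ i])
  ultimately show ?thesis by blast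
qed

lemma compact_std_triangle: "compact std_triangle"
proof -
  have "std_triangle = (\<Inter>i. {b. 0 \<le> b $ i}) \<inter> {b. (\<Sum>i\<in>UNIV. b $ i) = 1}"
    by (auto simp: std_triangle_def)
  also have "closed \<dots>"
    by (intro closed_Int closed_INT ballI closed_Collect_le closed_Collect_eq continuous_intros)
  finally have "closed std_triangle" .
  moreover have "norm b \<le> 1" if "b \<in> std_triangle" for b
  proof -
    have "norm b \<le> (\<Sum>i\<in>UNIV. \<bar>b $ i\<bar>)" by (rule norm_le_l1_cart)
    then show ?thesis using that by (simp add: std_triangle_def)
  qed
  then have "bounded std_triangle" by (auto simp: bounded_iff)
  ultimately show ?thesis by (simp add: compact_eq_bounded_closed)
qed

lemma compact_face: "compact (face J)"
proof -
  have "face J = std_triangle \<inter> (\<Inter>i\<in>- J. {b. b $ i = 0})" by (auto simp: face_def)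
  moreover have "closed (\<Inter>i\<in>- J. {b :: real^3. b $ i = 0})"
    by (intro closed_INT ballI closed_Collect_eq continuous_intros)
  ultimately show ?thesis using compact_std_triangle by (simp add: compact_Int_closed)
qed

lemma corners_in_closure_open_edge: "{corner (i + 1), corner (i + 2)} \<subseteq> closure (open_face (- {i}))"
proof -
  have sub: "open_segment (corner (i + 1)) (corner (i + 2)) \<subseteq> open_face (- {i})"
  proof
    fix b assume "b \<in> open_segment (corner (i + 1)) (corner (i + 2))"
    then obtain u where u: "0 < u" "u < 1" and b: "b = (1 - u) *\<^sub>R corner (i + 1) + u *\<^sub>R corner (i + 2)"
      by (auto simp: in_segment)
    show "b \<in> open_face (- {i})"
      using u by (simp add: b open_face_def std_triangle_def all_three[of _ i] corner_def axis_def sum_three[of _ i])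
  qed
  have "corner (i + 1) \<noteq> corner (i + 2)" by (simp add: corner_def axis_eq_axis)
  then have "closed_segment (corner (i + 1)) (corner (i + 2)) \<subseteq> closure (open_face (- {i}))"
    using closure_mono[OF sub] by simp
  then show ?thesis using ends_in_segment by blast
qed

text \<open>
  The closed side is the closure of the open one, so equal open sides have equal closed sides by
  compactness.  An end point does not lie on the open edge, since the images of open faces of
  different dimensions are disjoint; so it is an end point of the other side.
\<close>
lemma side_endpoints:
  assumes cd: "cell_decomposition M \<phi>" and eq: "side \<phi> (t, i) = side \<phi> (t', i')"
  shows "{\<phi> t (corner (i + 1)), \<phi> t (corner (i + 2))} \<subseteq> {\<phi> t' (corner (i' + 1)), \<phi> t' (corner (i' + 2))}"
proof -
  have cont: "continuous_on std_triangle (\<phi> t)" for t using cd by (simp add: cell_decomposition_def)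
  have "closed (\<phi> t' ` face (- {i'}))"
    by (intro compact_imp_closed compact_continuous_image compact_face continuous_on_subset[OF cont])
      (auto simp: face_def)
  moreover have "\<phi> t ` open_face (- {i}) \<subseteq> \<phi> t' ` face (- {i'})"
    using eq unfolding side_def face_edge[of i'] by auto
  moreover have "closure (open_face (- {i})) \<subseteq> std_triangle"
    by (intro closure_minimal compact_imp_closed[OF compact_std_triangle]) (auto simp: open_face_def)
  ultimately have "\<phi> t ` closure (open_face (- {i})) \<subseteq> \<phi> t' ` face (- {i'})"
    by (intro image_closure_subset continuous_on_subset[OF cont]) auto
  then have sub: "{\<phi> t (corner (i + 1)), \<phi> t (corner (i + 2))} \<subseteq> \<phi> t' ` face (- {i'})"
    using corners_in_closure_open_edge[of i] by blast
  moreover have "\<phi> t (corner j) \<notin> \<phi> t' ` open_face (- {i'})" for j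
  proof
    assume "\<phi> t (corner j) \<in> \<phi> t' ` open_face (- {i'})"
    then have "\<phi> t ` open_face {j} \<inter> \<phi> t' ` open_face (- {i'}) \<noteq> {}" by (simp add: open_face_singleton)
    then have "card {j} = card (- {i'})" using cd unfolding cell_decomposition_def by blast
    moreover have "- {i'} = {i' + 1, i' + 2}" using UNIV_three[of i'] by auto
    ultimately show False by simp
  qed
  ultimately show ?thesis unfolding face_edge by blast
qed

lemma vertex_sum_linear: "vertex_sum \<phi> (x + c *\<^sub>R y) v = vertex_sum \<phi> x v + c * vertex_sum \<phi> y v"
  by (simp add: vertex_sum_def sum.distrib sum_distrib_left)

lemma vertex_sum_side_vector:
  "vertex_sum \<phi> (side_vector (t, i)) v =
    (if \<phi> t (corner (i + 1)) = v then 1 else 0) + (if \<phi> t (corner (i + 2)) = v then 1 else 0)"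
proof -
  have "vertex_sum \<phi> (axis (t, j) 1) v = (if \<phi> t (corner j) = v then 1 else 0)" for j
  proof -
    have "vertex_sum \<phi> (axis (t, j) 1) v = (\<Sum>s | \<phi> (fst s) (corner (snd s)) = v. if s = (t, j) then 1 else 0)"
      unfolding vertex_sum_def by (intro sum.cong refl) (simp add: axis_def)
    then show ?thesis by (subst (asm) sum.delta) auto
  qed
  then show ?thesis
    using vertex_sum_linear[of \<phi> "axis (t, i + 1) 1" 1 "axis (t, i + 2) 1" v] by (simp add: side_vector_def)
qed

text \<open>
  A generator of \<open>C\<close> adds 1 to the angle sum at each end point of one side and subtracts 1 at each
  end point of another side of the same edge.  The unordered pairs of end points agree, with
  multiplicity when they coincide.
\<close>
lemma vertex_sum_C_space:
  assumes cd: "cell_decomposition M \<phi>" and c: "c \<in> C_space M \<phi>"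
  shows "vertex_sum \<phi> c v = 0"
  using c unfolding C_space_def
proof (induction rule: span_induct_alt)
  case base
  then show ?case by (simp add: vertex_sum_def)
next
  case (step a g c)
  then obtain s s' where g: "g = side_vector s - side_vector s'" and eq: "side \<phi> s = side \<phi> s'" by blast
  obtain t i where s: "s = (t, i)" by (cases s)
  obtain t' i' where s': "s' = (t', i')" by (cases s')
  have "{\<phi> t (corner (i + 1)), \<phi> t (corner (i + 2))} = {\<phi> t' (corner (i' + 1)), \<phi> t' (corner (i' + 2))}"
    using side_endpoints[OF cd] eq unfolding s s' by (metis subset_antisym)
  then have "vertex_sum \<phi> (side_vector s) v = vertex_sum \<phi> (side_vector s') v"
    unfolding s s' vertex_sum_side_vector doubleton_eq_iff by (elim disjE conjE) simp_all
  then have "vertex_sum \<phi> g v = 0"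
    using vertex_sum_linear[of \<phi> "side_vector s" "-1" "side_vector s'" v] by (simp add: g)
  then show ?case using step vertex_sum_linear[of \<phi> c a g v] by (simp add: add.commute)
qed

lemma V_space_translate:
  assumes "cell_decomposition M \<phi>" "x \<in> V_space M \<phi>" "y - x \<in> C_space M \<phi>"
  shows "y \<in> V_space M \<phi>"
proof -
  have "vertex_sum \<phi> y v = vertex_sum \<phi> x v" for v
    using vertex_sum_C_space[OF assms(1,3)] vertex_sum_linear[of \<phi> x 1 "y - x" v] by simp
  then show ?thesis using assms(2) by (simp add: V_space_def)
qed

section \<open>Uniform angle systems as critical points\<close>

lemma angle_systems_eq: "angle_systems M \<phi> = {x \<in> V_space M \<phi>. hyperbolic x}"
proof -
  have "x $ s < pi" if "hyperbolic x" for x :: "real^('f::finite \<times> 3)" and s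
    using hyperbolic_prism_angle[OF that, of "(fst s, Inl (snd s))"] by simp
  then show ?thesis by (auto simp: angle_systems_def hyperbolic_def curvature_def)
qed

text \<open>
  The condition on one pair of sides of an edge is the vanishing of the derivative along one generator
  of \<open>C\<close>.
\<close>
lemma uniform_iff_critical:
  assumes u: "u \<in> angle_systems M \<phi>"
  shows "uniform M \<phi> u \<longleftrightarrow> (\<forall>c\<in>C_space M \<phi>. prism_volume_deriv u c = 0)"
proof
  have h: "hyperbolic u" using u by (simp add: angle_systems_eq)
  have zero: "prism_volume_deriv u 0 = 0" using prism_volume_deriv_linear[of u 0 1 0] by simp
  show "\<forall>c\<in>C_space M \<phi>. prism_volume_deriv u c = 0" if un: "uniform M \<phi> u"
  proof
    fix c assume "c \<in> C_space M \<phi>"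
    then show "prism_volume_deriv u c = 0" unfolding C_space_def
    proof (induction rule: span_induct_alt)
      case base
      then show ?case by (rule zero)
    next
      case (step a g c)
      then obtain s s' where g: "g = side_vector s - side_vector s'" and eq: "side \<phi> s = side \<phi> s'"
        and e: "side \<phi> s \<in> edges \<phi> - boundary_edges M \<phi>" by blast
      have "side_length u s = side_length u s'" using un e eq unfolding uniform_def by metis
      then have "prism_volume_deriv u g = 0" unfolding g side_length_eq_iff[OF h] .
      then show ?case using step prism_volume_deriv_linear[of u c a g] by (simp add: add.commute)
    qed
  qed
  show "uniform M \<phi> u" if cr: "\<forall>c\<in>C_space M \<phi>. prism_volume_deriv u c = 0"
    unfolding uniform_def
  proof (intro conjI u ballI allI impI)
    fix e s s' assume e: "e \<in> edges \<phi> - boundary_edges M \<phi>" "side \<phi> s = e \<and> side \<phi> s' = e"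
    show "side_length u s = side_length u s'"
    proof (cases "s = s'")
      case False
      then have "side_vector s - side_vector s' \<in> C_space M \<phi>"
        unfolding C_space_def using e by (intro span_base) blast
      then show ?thesis using cr side_length_eq_iff[OF h] by blast
    qed simp
  qed
qed

text \<open>
  A weakly hyperbolic point is a limit of points on the segment from it to an interior point.
\<close>
lemma angle_systems_boundaryI:
  assumes yV: "y \<in> V_space M \<phi>" and y: "weakly_hyperbolic y" "\<not> hyperbolic y" and x: "x \<in> angle_systems M \<phi>"
  shows "y \<in> angle_systems_boundary M \<phi>"
proof -
  have V: "y + s *\<^sub>R (x - y) \<in> V_space M \<phi>" for s
  proof -
    have "x = y + 1 *\<^sub>R (x - y)" by simp
    then have "vertex_sum \<phi> x v = vertex_sum \<phi> y v + 1 * vertex_sum \<phi> (x - y) v" for v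
      using vertex_sum_linear[of \<phi> y 1 "x - y"] by simp
    moreover have "x \<in> V_space M \<phi>" using x by (simp add: angle_systems_eq)
    ultimately show ?thesis using yV by (auto simp: V_space_def vertex_sum_linear)
  qed
  have S: "y + s *\<^sub>R (x - y) \<in> angle_systems M \<phi>" if "0 < s" "s < 1" for s
    using hyperbolic_between[of y x s] y x V that by (simp add: angle_systems_eq)
  have "y \<in> top_of_set (V_space M \<phi>) closure_of angle_systems M \<phi>"
    unfolding in_closure_of
  proof (intro conjI allI impI)
    fix T assume T: "y \<in> T \<and> openin (top_of_set (V_space M \<phi>)) T"
    then obtain W where W: "open W" "T = V_space M \<phi> \<inter> W" by (auto simp: openin_open)
    have "((\<lambda>s. y + s *\<^sub>R (x - y)) \<longlongrightarrow> y + 0 *\<^sub>R (x - y)) (at_right 0)"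
      by (intro tendsto_intros)
    then have "\<forall>\<^sub>F s in at_right 0. y + s *\<^sub>R (x - y) \<in> W"
      using W T by (intro topological_tendstoD) auto
    moreover have "\<forall>\<^sub>F s::real in at_right 0. 0 < s \<and> s < 1"
      by (rule eventually_at_rightI[of 0 1]) auto
    ultimately have "\<forall>\<^sub>F s in at_right 0. y + s *\<^sub>R (x - y) \<in> W \<and> 0 < s \<and> s < 1"
      by (rule eventually_conj)
    then obtain s where "y + s *\<^sub>R (x - y) \<in> W" "0 < s" "s < 1"
      using eventually_happens'[OF trivial_limit_at_right_real] by blast
    then show "\<exists>z. z \<in> angle_systems M \<phi> \<and> z \<in> T" using S V W by blast
  qed (use yV in simp)
  moreover have "y \<notin> top_of_set (V_space M \<phi>) interior_of angle_systems M \<phi>"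
    using interior_of_subset[of "top_of_set (V_space M \<phi>)" "angle_systems M \<phi>"] y(2)
    by (auto simp: angle_systems_eq)
  ultimately show ?thesis by (simp add: angle_systems_boundary_def frontier_of_def)
qed

theorem theorem1:
  fixes M :: "'a::t2_space set" and U :: "'b::t2_space set" and p :: "'b \<Rightarrow> 'a"
    and \<phi> :: "'f::finite \<Rightarrow> real^3 \<Rightarrow> 'a" and x :: "real^('f \<times> 3)"
  assumes "compact_surface M"
    and "triangular_decomposition M U p \<phi>"
    and "euler_characteristic \<phi> < 0"
    and "x \<in> angle_systems M \<phi>"
  shows "(\<forall>u v. uniform M \<phi> u \<and> conformally_equivalent M \<phi> u x \<and>
                uniform M \<phi> v \<and> conformally_equivalent M \<phi> v x \<longrightarrow> u = v) \<and>
         ({x + c | c. c \<in> C_space M \<phi>} \<inter> bad_boundary M \<phi> = {} \<longrightarrow>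
            (\<exists>u. uniform M \<phi> u \<and> conformally_equivalent M \<phi> u x))"
proof (intro conjI allI impI)
  have cd: "cell_decomposition M \<phi>" using assms(2) by (simp add: triangular_decomposition_def)
  have xh: "hyperbolic x" and xV: "x \<in> V_space M \<phi>" using assms(4) by (auto simp: angle_systems_eq)
  have sub: "subspace (C_space M \<phi>)" unfolding C_space_def by (rule subspace_span)
  show "u = v" if uv: "uniform M \<phi> u \<and> conformally_equivalent M \<phi> u x \<and>
                uniform M \<phi> v \<and> conformally_equivalent M \<phi> v x" for u v
  proof (rule ccontr)
    assume "u \<noteq> v"
    have S: "u \<in> angle_systems M \<phi>" "v \<in> angle_systems M \<phi>" using uv by (auto simp: uniform_def)
    have "(v - x) - (u - x) \<in> C_space M \<phi>"
      using uv subspace_diff[OF sub] unfolding conformally_equivalent_def by blast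
    then have "v - u \<in> C_space M \<phi>" by simp
    then have "prism_volume_deriv u (v - u) = 0" "prism_volume_deriv v (v - u) = 0"
      using uv uniform_iff_critical[OF S(1)] uniform_iff_critical[OF S(2)] by auto
    then show False
      using prism_volume_strictly_concave[of u v] S \<open>u \<noteq> v\<close> by (simp add: angle_systems_eq)
  qed
  assume dis: "{x + c | c. c \<in> C_space M \<phi>} \<inter> bad_boundary M \<phi> = {}"
  have "\<exists>t. legal y t" if y: "y - x \<in> C_space M \<phi>" "weakly_hyperbolic y" "\<not> hyperbolic y" for y
  proof -
    have "y \<in> angle_systems_boundary M \<phi>"
      by (rule angle_systems_boundaryI[OF V_space_translate[OF cd xV y(1)] y(2,3) assms(4)])
    moreover have "y \<in> {x + c | c. c \<in> C_space M \<phi>}"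
      using y(1) by (intro CollectI exI[of _ "y - x"]) simp
    ultimately show ?thesis using dis unfolding bad_boundary_def by blast
  qed
  then obtain u where u: "u - x \<in> C_space M \<phi>" "hyperbolic u" "\<And>c. c \<in> C_space M \<phi> \<Longrightarrow> prism_volume_deriv u c = 0"
    using critical_point_exists[OF sub xh] by blast
  then have "u \<in> angle_systems M \<phi>" using V_space_translate[OF cd xV u(1)] by (simp add: angle_systems_eq)
  then show "\<exists>u. uniform M \<phi> u \<and> conformally_equivalent M \<phi> u x"
    using u uniform_iff_critical[of u] unfolding conformally_equivalent_def by blast
qed

end
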